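(* Let $\Omega$ be a future complete domain in $\mathbf{R}^{1,n}$ such that $\partial\Omega$ is stably acausal, or a bounded, convex and causally convex domain in $\mathbf{R}^{1,n}$ such that $\partial_c^+\Omega$ and $\partial_c^-\Omega$ are stably acausal. Then $(\Omega,\delta_\Omega)$ is Gromov hyperbolic.
   Context: Minkowski space: $\mathbf{R}^{1,n}$ ($n\ge 1$) is $\mathbf{R}\times\mathbf{R}^n$ with coordinates $(t,p)$, flat metric $\mathbf{b}=-dt^2+dp_1^2+\dots+dp_n^2$ and time orientation $\partial_t$. A nonzero vector $v$ is lightlike if $\mathbf{b}(v,v)=0$, causal if $\mathbf{b}(v,v)\le 0$, and a causal vector is future if $\mathbf{b}(v,\partial_t)<0$; a future causal curve is a piecewise smooth curve with future causal velocity. A domain is a nonempty, connected, proper open subset of $\mathbf{R}^{1,n}$. A domain $\Omega$ is causally convex if every causal curve of $\mathbf{R}^{1,n}$ with endpoints in $\Omega$ is contained in $\Omega$, and future complete if every future causal curve of $\mathbf{R}^{1,n}$ starting in $\Omega$ is contained in $\Omega$. Markowitz pseudodistance: let $I=(-1,1)$ and $\rho_I(s,t)=\left|\ln\frac{(s-1)(t+1)}{(s+1)(t-1)}\right|$. For a domain $\Omega$, a projectively parametrized lightlike geodesic of $\Omega$ is a curve $\gamma:I\to\Omega$, $\gamma(s)=x+h(s)v$, with $v$ lightlike and $h$ a (nonconstant) real homography without pole in $I$. Then $\delta_\Omega(x,y)=\inf\sum_{k=1}^m\rho_I(s_k,t_k)$, the infimum being over all finite families of such geodesics $\gamma_1,\dots,\gamma_m$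 and points $s_k,t_k\in I$ with $\gamma_1(s_1)=x$, $\gamma_m(t_m)=y$, $\gamma_k(t_k)=\gamma_{k+1}(s_{k+1})$. Causal boundary: a causally convex domain can be written $\Omega=\{(t,p)\in\mathbf{R}\times U : f_-(p)<t<f_+(p)\}$ with $U\subset\mathbf{R}^n$ open and $f_\pm:\overline U\to\overline{\mathbf{R}}$ 1-Lipschitz, $f_-<f_+$ on $U$, $f_-=f_+$ on $\partial U$. $\partial_c^+\Omega$ (resp. $\partial_c^-\Omega$) is the graph $\{(f_\pm(p),p)\}$ of $f_+$ (resp. $f_-$), empty if that function is infinite. Stable acausality: for $\varepsilon>0$ let $\mathbf{b}_\varepsilon=-(1+\varepsilon)^2dt^2+dp_1^2+\dots+dp_n^2$. A subset of $\mathbf{R}^{1,n}$ is $\varepsilon$-stably acausal if no two distinct points of it are causally related for $\mathbf{b}_\varepsilon$; it is stably acausal if it is $\varepsilon$-stably acausal for some $\varepsilon>0$. Gromov hyperbolicity of a proper geodesic metric space means that there is a constant $r>0$ such that each side of every geodesic triangle lies in the $r$-neighborhood of the union of the other two sides. *)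

theory Defs
  imports "HOL-Analysis.Analysis"
begin

section \<open>Minkowski space and causal curves\<close>

text \<open>A point or vector of \<open>R^{1,n}\<close> is a pair \<open>(t, p)\<close>, with \<open>n = CARD('n) \<ge> 1\<close>. The notions below that
  depend on the metric take the bilinear form \<open>g\<close> as a parameter, because they are needed both for
  the flat Minkowski metric and for the metrics with wider light cones.\<close>

type_synonym 'n mink = "real \<times> (real ^ 'n)"

definition mink_form :: "'n::finite mink \<Rightarrow> 'n mink \<Rightarrow> real" where
  "mink_form v w = - (fst v * fst w) + snd v \<bullet> snd w"

definition mink_form_eps :: "real \<Rightarrow> 'n::finite mink \<Rightarrow> 'n mink \<Rightarrow> real" where
  "mink_form_eps \<epsilon> v w = - ((1 + \<epsilon>)\<^sup>2 * (fst v * fst w)) + snd v \<bullet> snd w"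

definition time_vec :: "'n::finite mink" where
  "time_vec = (1, 0)"

definition lightlike :: "('n::finite mink \<Rightarrow> 'n mink \<Rightarrow> real) \<Rightarrow> 'n mink \<Rightarrow> bool" where
  "lightlike g v \<longleftrightarrow> v \<noteq> 0 \<and> g v v = 0"

definition causal_vec :: "('n::finite mink \<Rightarrow> 'n mink \<Rightarrow> real) \<Rightarrow> 'n mink \<Rightarrow> bool" where
  "causal_vec g v \<longleftrightarrow> v \<noteq> 0 \<and> g v v \<le> 0"

definition future_causal_vec :: "('n::finite mink \<Rightarrow> 'n mink \<Rightarrow> real) \<Rightarrow> 'n mink \<Rightarrow> bool" where
  "future_causal_vec g v \<longleftrightarrow> causal_vec g v \<and> g v time_vec < 0"

definition past_causal_vec :: "('n::finite mink \<Rightarrow> 'n mink \<Rightarrow> real) \<Rightarrow> 'n mink \<Rightarrow> bool" where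
  "past_causal_vec g v \<longleftrightarrow> causal_vec g v \<and> g v time_vec > 0"

text \<open>Infinitely differentiable on \<open>J\<close>; \<open>D k\<close> is the \<open>k\<close>-th derivative, one-sided at the endpoints
  when \<open>J\<close> is a closed interval.\<close>

definition smooth_curve_on :: "real set \<Rightarrow> (real \<Rightarrow> 'a::real_normed_vector) \<Rightarrow> bool" where
  "smooth_curve_on J \<gamma> \<longleftrightarrow>
     (\<exists>D :: nat \<Rightarrow> real \<Rightarrow> 'a. D 0 = \<gamma> \<and>
        (\<forall>k. \<forall>t\<in>J. (D k has_vector_derivative D (Suc k) t) (at t within J)))"

text \<open>A piecewise smooth curve on \<open>[a, b]\<close> all of whose velocities satisfy \<open>P\<close>; at a break point both
  one-sided velocities are meant. Continuity across break points is automatic, since the pieces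
  are closed intervals.\<close>

definition piecewise_smooth_curve ::
    "('n::finite mink \<Rightarrow> bool) \<Rightarrow> (real \<Rightarrow> 'n mink) \<Rightarrow> real \<Rightarrow> real \<Rightarrow> bool" where
  "piecewise_smooth_curve P \<gamma> a b \<longleftrightarrow>
     (\<exists>(m::nat) \<tau> :: nat \<Rightarrow> real. 0 < m \<and> \<tau> 0 = a \<and> \<tau> m = b \<and>
        (\<forall>i<m. \<tau> i < \<tau> (Suc i) \<and>
           smooth_curve_on {\<tau> i..\<tau> (Suc i)} \<gamma> \<and>
           (\<forall>t\<in>{\<tau> i..\<tau> (Suc i)}. P (vector_derivative \<gamma> (at t within {\<tau> i..\<tau> (Suc i)})))))"

definition future_causal_curve ::
    "('n::finite mink \<Rightarrow> 'n mink \<Rightarrow> real) \<Rightarrow> (real \<Rightarrow> 'n mink) \<Rightarrow> real \<Rightarrow> real \<Rightarrow> bool" where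
  "future_causal_curve g \<gamma> a b \<longleftrightarrow> piecewise_smooth_curve (future_causal_vec g) \<gamma> a b"

text \<open>The time direction of a causal curve must not change at a break point: it is future on all
  pieces or past on all pieces.\<close>

definition causal_curve ::
    "('n::finite mink \<Rightarrow> 'n mink \<Rightarrow> real) \<Rightarrow> (real \<Rightarrow> 'n mink) \<Rightarrow> real \<Rightarrow> real \<Rightarrow> bool" where
  "causal_curve g \<gamma> a b \<longleftrightarrow>
     future_causal_curve g \<gamma> a b \<or> piecewise_smooth_curve (past_causal_vec g) \<gamma> a b"

section \<open>Domains\<close>

definition mink_domain :: "'n::finite mink set \<Rightarrow> bool" where
  "mink_domain \<Omega> \<longleftrightarrow> \<Omega> \<noteq> {} \<and> connected \<Omega> \<and> \<Omega> \<noteq> UNIV \<and> open \<Omega>"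

definition causally_convex :: "'n::finite mink set \<Rightarrow> bool" where
  "causally_convex \<Omega> \<longleftrightarrow>
     (\<forall>\<gamma> a b. causal_curve mink_form \<gamma> a b \<and> \<gamma> a \<in> \<Omega> \<and> \<gamma> b \<in> \<Omega> \<longrightarrow> \<gamma> ` {a..b} \<subseteq> \<Omega>)"

definition future_complete :: "'n::finite mink set \<Rightarrow> bool" where
  "future_complete \<Omega> \<longleftrightarrow>
     (\<forall>\<gamma> a b. future_causal_curve mink_form \<gamma> a b \<and> \<gamma> a \<in> \<Omega> \<longrightarrow> \<gamma> ` {a..b} \<subseteq> \<Omega>)"

section \<open>Stable acausality\<close>

definition causally_related ::
    "('n::finite mink \<Rightarrow> 'n mink \<Rightarrow> real) \<Rightarrow> 'n mink \<Rightarrow> 'n mink \<Rightarrow> bool" where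
  "causally_related g x y \<longleftrightarrow> (\<exists>\<gamma> a b. causal_curve g \<gamma> a b \<and> \<gamma> a = x \<and> \<gamma> b = y)"

definition eps_stably_acausal :: "real \<Rightarrow> 'n::finite mink set \<Rightarrow> bool" where
  "eps_stably_acausal \<epsilon> S \<longleftrightarrow>
     (\<forall>x\<in>S. \<forall>y\<in>S. x \<noteq> y \<longrightarrow> \<not> causally_related (mink_form_eps \<epsilon>) x y)"

definition stably_acausal :: "'n::finite mink set \<Rightarrow> bool" where
  "stably_acausal S \<longleftrightarrow> (\<exists>\<epsilon>>0. eps_stably_acausal \<epsilon> S)"

section \<open>Causal boundary\<close>

text \<open>A 1-Lipschitz function with values in the extended reals is either finite everywhere or
  constantly \<open>\<infinity>\<close> or constantly \<open>-\<infinity>\<close>.\<close>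

definition ereal_lipschitz1 :: "'a::metric_space set \<Rightarrow> ('a \<Rightarrow> ereal) \<Rightarrow> bool" where
  "ereal_lipschitz1 S f \<longleftrightarrow>
     (\<exists>g. 1-lipschitz_on S g \<and> (\<forall>p\<in>S. f p = ereal (g p))) \<or>
     (\<forall>p\<in>S. f p = \<infinity>) \<or> (\<forall>p\<in>S. f p = -\<infinity>)"

text \<open>Only the values of \<open>fm\<close> and \<open>fp\<close> on the closure of \<open>U\<close> matter. For a causally convex domain \<open>\<Omega>\<close>
  such a representation exists, \<open>U\<close> is unique, and so are these values, by continuity.\<close>

definition causal_representation ::
    "'n::finite mink set \<Rightarrow> (real ^ 'n) set \<Rightarrow> (real ^ 'n \<Rightarrow> ereal) \<Rightarrow> (real ^ 'n \<Rightarrow> ereal) \<Rightarrow> bool" where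
  "causal_representation \<Omega> U fm fp \<longleftrightarrow>
     open U \<and> ereal_lipschitz1 (closure U) fm \<and> ereal_lipschitz1 (closure U) fp \<and>
     (\<forall>p\<in>U. fm p < fp p) \<and> (\<forall>p\<in>frontier U. fm p = fp p) \<and>
     \<Omega> = {(t, p). p \<in> U \<and> fm p < ereal t \<and> ereal t < fp p}"

definition future_causal_boundary :: "'n::finite mink set \<Rightarrow> 'n mink set" where
  "future_causal_boundary \<Omega> =
     {(t, p). \<exists>U fm fp. causal_representation \<Omega> U fm fp \<and> p \<in> closure U \<and> fp p = ereal t}"

definition past_causal_boundary :: "'n::finite mink set \<Rightarrow> 'n mink set" where
  "past_causal_boundary \<Omega> =
     {(t, p). \<exists>U fm fp. causal_representation \<Omega> U fm fp \<and> p \<in> closure U \<and> fm p = ereal t}"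

section \<open>The Markowitz pseudodistance\<close>

definition rho_I :: "real \<Rightarrow> real \<Rightarrow> real" where
  "rho_I s t = \<bar>ln (((s - 1) * (t + 1)) / ((s + 1) * (t - 1)))\<bar>"

definition homography_on_I :: "(real \<Rightarrow> real) \<Rightarrow> bool" where
  "homography_on_I h \<longleftrightarrow>
     (\<exists>a b c d. a * d - b * c \<noteq> 0 \<and>
        (\<forall>s\<in>{-1<..<1}. c * s + d \<noteq> 0 \<and> h s = (a * s + b) / (c * s + d)))"

definition proj_lightlike_geodesic :: "'n::finite mink set \<Rightarrow> (real \<Rightarrow> 'n mink) \<Rightarrow> bool" where
  "proj_lightlike_geodesic \<Omega> \<gamma> \<longleftrightarrow>
     (\<exists>x v h. lightlike mink_form v \<and> homography_on_I h \<and>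
        (\<forall>s\<in>{-1<..<1}. \<gamma> s = x + h s *\<^sub>R v \<and> \<gamma> s \<in> \<Omega>))"

definition lightlike_chain ::
    "'n::finite mink set \<Rightarrow> 'n mink \<Rightarrow> 'n mink \<Rightarrow>
     nat \<Rightarrow> (nat \<Rightarrow> real \<Rightarrow> 'n mink) \<Rightarrow> (nat \<Rightarrow> real) \<Rightarrow> (nat \<Rightarrow> real) \<Rightarrow> bool" where
  "lightlike_chain \<Omega> x y m \<gamma> s t \<longleftrightarrow>
     1 \<le> m \<and>
     (\<forall>k\<in>{1..m}. proj_lightlike_geodesic \<Omega> (\<gamma> k) \<and> s k \<in> {-1<..<1} \<and> t k \<in> {-1<..<1}) \<and>
     \<gamma> 1 (s 1) = x \<and> \<gamma> m (t m) = y \<and>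
     (\<forall>k\<in>{1..<m}. \<gamma> k (t k) = \<gamma> (k + 1) (s (k + 1)))"

text \<open>For \<open>x\<close> and \<open>y\<close> in a domain, which is open and connected, there is always a chain, so this is the
  infimum of a nonempty set of nonnegative reals. Off \<open>\<Omega>\<close> the value is set to 0 because the
  \<open>Metric_space\<close> locale asks for nonnegativity and symmetry at all points of the type.\<close>

definition markowitz_dist :: "'n::finite mink set \<Rightarrow> 'n mink \<Rightarrow> 'n mink \<Rightarrow> real" where
  "markowitz_dist \<Omega> x y =
     (if x \<in> \<Omega> \<and> y \<in> \<Omega>
      then Inf {\<Sum>k = 1..m. rho_I (s k) (t k) | m \<gamma> s t. lightlike_chain \<Omega> x y m \<gamma> s t}
      else 0)"

section \<open>Gromov hyperbolicity\<close>

definition proper_metric :: "'a set \<Rightarrow> ('a \<Rightarrow> 'a \<Rightarrow> real) \<Rightarrow> bool" where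
  "proper_metric M d \<longleftrightarrow>
     (\<forall>x\<in>M. \<forall>r. compactin (Metric_space.mtopology M d) (Metric_space.mcball M d x r))"

definition geodesic_segment :: "'a set \<Rightarrow> ('a \<Rightarrow> 'a \<Rightarrow> real) \<Rightarrow> 'a \<Rightarrow> 'a \<Rightarrow> 'a set \<Rightarrow> bool" where
  "geodesic_segment M d x y S \<longleftrightarrow>
     (\<exists>c L. 0 \<le> L \<and> c ` {0..L} \<subseteq> M \<and> c 0 = x \<and> c L = y \<and>
        (\<forall>s\<in>{0..L}. \<forall>t\<in>{0..L}. d (c s) (c t) = \<bar>s - t\<bar>) \<and> S = c ` {0..L})"

definition geodesic_metric :: "'a set \<Rightarrow> ('a \<Rightarrow> 'a \<Rightarrow> real) \<Rightarrow> bool" where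
  "geodesic_metric M d \<longleftrightarrow> (\<forall>x\<in>M. \<forall>y\<in>M. \<exists>S. geodesic_segment M d x y S)"

definition metric_nbhd :: "'a set \<Rightarrow> ('a \<Rightarrow> 'a \<Rightarrow> real) \<Rightarrow> real \<Rightarrow> 'a set \<Rightarrow> 'a set" where
  "metric_nbhd M d r S = {x \<in> M. \<exists>y\<in>S. d x y < r}"

text \<open>Being a proper geodesic metric space is part of the notion; without geodesics the condition on
  triangles could hold vacuously.\<close>

definition gromov_hyperbolic :: "'a set \<Rightarrow> ('a \<Rightarrow> 'a \<Rightarrow> real) \<Rightarrow> bool" where
  "gromov_hyperbolic M d \<longleftrightarrow>
     Metric_space M d \<and> proper_metric M d \<and> geodesic_metric M d \<and>
     (\<exists>r>0. \<forall>x\<in>M. \<forall>y\<in>M. \<forall>z\<in>M. \<forall>A B C.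
        geodesic_segment M d y z A \<and> geodesic_segment M d z x B \<and> geodesic_segment M d x y C \<longrightarrow>
        A \<subseteq> metric_nbhd M d r (B \<union> C) \<and>
        B \<subseteq> metric_nbhd M d r (C \<union> A) \<and>
        C \<subseteq> metric_nbhd M d r (A \<union> B))"

end

(* Let D x be the distance from x to the complement of the domain. Stable acausality of the boundary
   forces a null ray from x, run towards the future or towards the past, to leave the domain within
   a time O(D x). Since a null link of Markowitz length l is dominated by the half-line ending at that
   exit point, it moves x by at most O(D x) (exp l - 1); so delta(x,y) >= c ln (1 + |x-y| / D x).
   In the other direction, from every point of the domain one can walk away from the boundary along a
   straight segment (upwards for a future complete domain, towards a fixed centre for a bounded convex
   one), which gives delta(x,y) <= C ln (1 + |x-y| / min (D x) (D y)) + C. Thus delta behaves like the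
   quasihyperbolic metric of a uniform domain. Such a metric is proper; it is geodesic because it is an
   infimum of lengths. As in Gehring-Osgood, each point p of a geodesic from x to y satisfies
   min |p-x| |p-y| = O(D p) and D p = O(max |x-y| (D x) (D y)), and thin triangles follow by
   comparing scales near the vertices. *)

theory Submission
  imports Defs
begin

section \<open>Quasihyperbolic metrics\<close>

text \<open>Stability matters because mere acausality only gives a boundary of slope at most 1,
  along which a null ray could run for ever. Slope at most 1/(1+\<epsilon>) lets the ray gain on the
  boundary at a definite rate. One time direction suffices for the lower bound. A homography without
  pole in I maps I onto an interval or a half-line, and on a half-line the projective distance is
  |ln (a/b)|, with a and b the distances to its end. That already controls displacement, whatever
  happens at the other end. Geodesics of the Markowitz distance are known only to exist, as limits
  of chains, so there is no curve along which to integrate 1/D. The Gehring-Osgood argument is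
  therefore run on time alone: it uses the lower and upper logarithmic bounds and the isometric
  parametrization. For a thin triangle at p, choose the scale \<rho> comparable to D p. Either
  another side reaches height comparable to \<rho> near the vertex, or that side is short and the
  search passes to the next vertex. If every side is short, the height bound makes one endpoint of
  the original side high enough.\<close>

lemma infdist_compl_pos:
  fixes \<Omega> :: "'a::metric_space set"
  assumes "open \<Omega>" "\<Omega> \<noteq> UNIV" "x \<in> \<Omega>"
  shows "0 < infdist x (-\<Omega>)"
  using assms in_closed_iff_infdist_zero[of "-\<Omega>" x] infdist_nonneg[of x "-\<Omega>"]
  by (force simp: closed_def)

lemma infdist_compl_attained:
  fixes \<Omega> :: "'a::heine_borel set"
  assumes "open \<Omega>" "\<Omega> \<noteq> UNIV"
  obtains z where "z \<notin> \<Omega>" "infdist x (-\<Omega>) = dist x z"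
  using assms infdist_attains_inf[of "-\<Omega>" x] by (auto simp: closed_Compl)

lemma infdist_compl_ball: "dist x y < infdist x (-\<Omega>) \<Longrightarrow> y \<in> \<Omega>"
  using infdist_le[of y "-\<Omega>" x] by (cases "y \<in> \<Omega>") auto

text \<open>The least point where \<open>g\<close> is at least \<open>m\<close> replaces an
  arbitrary one from the intermediate value theorem: estimates at one scale need \<open>g\<close> to
  stay below the level up to that point.\<close>

lemma first_time_at_level:
  fixes g :: "real \<Rightarrow> real"
  assumes cont: "continuous_on {p..q} g" and "p \<le> q" "g p \<le> m" "m \<le> g q"
  obtains b where "b \<in> {p..q}" "g b = m" "\<And>u. u \<in> {p..b} \<Longrightarrow> g u \<le> m"
proof -
  let ?S = "{u \<in> {p..q}. m \<le> g u}"
  have "closed ?S" using cont by (intro continuous_on_closed_Collect_le continuous_intros) auto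
  moreover have "bounded ?S" by (rule bounded_subset[of "{p..q}"]) auto
  ultimately have "compact ?S" by (simp add: compact_eq_bounded_closed)
  moreover have "q \<in> ?S" using assms by simp
  ultimately obtain b where b: "b \<in> ?S" and least: "\<And>u. u \<in> ?S \<Longrightarrow> b \<le> u"
    using compact_attains_inf[of ?S] by blast
  have "\<exists>u\<ge>p. u \<le> b \<and> g u = m"
    using assms b continuous_on_subset[OF cont, of "{p..b}"] by (intro IVT') auto
  then have "g b = m" using least[of b] b least by (metis (mono_tags, lifting) atLeastAtMost_iff
    dual_order.trans mem_Collect_eq order_antisym order_refl)
  moreover have "g u \<le> m" if "u \<in> {p..b}" for u
    using least[of u] that b \<open>g b = m\<close> by (cases "u = b"; cases "m \<le> g u") auto
  ultimately show ?thesis using that b by blast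
qed

text \<open>\<open>lower\<close> is the bound d >= ln (1 + |x-y| / D x) / A, with D the distance to
  the complement, solved for the Euclidean distance; \<open>upper\<close> is its reverse up to
  constants. \<open>local_upper\<close> makes \<open>d\<close> continuous.
  \<open>almost_between\<close> records that \<open>d\<close> is an infimum over chains that can be
  cut at any length.\<close>

locale quasihyperbolic =
  fixes \<Omega> :: "'a::euclidean_space set" and d :: "'a \<Rightarrow> 'a \<Rightarrow> real" and A B C :: real
  assumes open_dom: "open \<Omega>" and proper_dom: "\<Omega> \<noteq> UNIV"
    and metric: "Metric_space \<Omega> d"
    and A_pos: "0 < A" and B_pos: "0 < B" and C_pos: "0 < C"
    and lower: "\<lbrakk>x \<in> \<Omega>; y \<in> \<Omega>\<rbrakk> \<Longrightarrow> dist x y \<le> infdist x (-\<Omega>) * (exp (A * d x y) - 1)"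
    and local_upper: "\<lbrakk>x \<in> \<Omega>; y \<in> \<Omega>; dist x y \<le> infdist x (-\<Omega>) / 8\<rbrakk>
      \<Longrightarrow> d x y \<le> C * dist x y / infdist x (-\<Omega>)"
    and upper: "\<lbrakk>x \<in> \<Omega>; y \<in> \<Omega>\<rbrakk>
      \<Longrightarrow> d x y \<le> B + B * ln (1 + dist x y / min (infdist x (-\<Omega>)) (infdist y (-\<Omega>)))"
    and almost_between: "\<lbrakk>x \<in> \<Omega>; y \<in> \<Omega>; 0 < e; 0 \<le> s; s \<le> d x y\<rbrakk>
      \<Longrightarrow> \<exists>z\<in>\<Omega>. d x z \<le> s \<and> d z y \<le> d x y - s + e"
begin

interpretation Metric_space \<Omega> d by (fact metric)

abbreviation D :: "'a \<Rightarrow> real" where "D x \<equiv> infdist x (-\<Omega>)"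

lemma D_pos: "x \<in> \<Omega> \<Longrightarrow> 0 < D x"
  by (rule infdist_compl_pos[OF open_dom proper_dom])

lemma D_pos_iff: "0 < D x \<longleftrightarrow> x \<in> \<Omega>"
  using D_pos[of x] infdist_zero[of x "-\<Omega>"] by fastforce

lemma D_lipschitz: "D x \<le> D y + dist x y"
  by (rule infdist_triangle)

lemma D_growth:
  assumes "x \<in> \<Omega>" "y \<in> \<Omega>" "d x y \<le> r"
  shows "D y \<le> D x * exp (A * r)" and "dist x y \<le> D x * (exp (A * r) - 1)"
proof -
  have "exp (A * d x y) \<le> exp (A * r)"
    using assms A_pos by simp
  then have "D x * (exp (A * d x y) - 1) \<le> D x * (exp (A * r) - 1)"
    using D_pos[OF assms(1)] by (intro mult_left_mono) auto
  with lower[OF assms(1,2)] show *: "dist x y \<le> D x * (exp (A * r) - 1)" by linarith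
  show "D y \<le> D x * exp (A * r)"
    using D_lipschitz[of y x] * by (simp add: dist_commute algebra_simps)
qed

section \<open>Continuity of the distance and properness\<close>

lemma continuous_on_d:
  assumes "x \<in> \<Omega>"
  shows "continuous_on \<Omega> (d x)"
  unfolding continuous_on_iff
proof (intro ballI allI impI)
  fix y and e :: real
  assume y: "y \<in> \<Omega>" and "0 < e"
  define r where "r = min (D y / 8) (e * D y / (2 * C))"
  have "0 < r" using D_pos[OF y] \<open>0 < e\<close> C_pos by (simp add: r_def)
  moreover have "dist (d x z) (d x y) < e" if z: "z \<in> \<Omega>" "dist z y < r" for z
  proof -
    have "dist y z \<le> D y / 8" "dist y z \<le> e * D y / (2 * C)"
      using z by (auto simp: r_def dist_commute)
    then have "d y z \<le> C * dist y z / D y" "C * dist y z / D y \<le> e / 2"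
      using local_upper[OF y z(1)] D_pos[OF y] C_pos by (auto simp: field_simps)
    moreover have "\<bar>d x z - d x y\<bar> \<le> d y z"
      using triangle[OF assms y z(1)] triangle[OF assms z(1) y] commute[of z y] by linarith
    ultimately have "\<bar>d x z - d x y\<bar> \<le> e / 2" by linarith
    then show ?thesis using \<open>0 < e\<close> by (simp add: dist_real_def)
  qed
  ultimately show "\<exists>r>0. \<forall>z\<in>\<Omega>. dist z y < r \<longrightarrow> dist (d x z) (d x y) < e" by blast
qed

lemma compact_ball:
  assumes x: "x \<in> \<Omega>"
  shows "compact {y \<in> \<Omega>. d x y \<le> r}"
proof -
  \<comment> \<open>By \<open>D_growth\<close> with the two points exchanged, the ball keeps this
    height. So it lies in a subset of \<Omega> that is closed in the whole space, where continuity
    of \<open>d x\<close> gives genuine closedness.\<close>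
  define E where "E = {y. D x * exp (- (A * r)) \<le> D y}"
  have E: "E \<subseteq> \<Omega>"
  proof
    fix y assume "y \<in> E"
    then have "0 < D y" using D_pos[OF x] unfolding E_def
      by (smt (verit) exp_gt_zero mem_Collect_eq mult_pos_pos)
    then show "y \<in> \<Omega>" by (simp add: D_pos_iff)
  qed
  have "closed E" unfolding E_def by (intro closed_Collect_le continuous_intros)
  moreover have "continuous_on E (d x)" using continuous_on_d[OF x] E continuous_on_subset by blast
  ultimately have "closed {y \<in> E. d x y \<le> r}"
    by (intro continuous_on_closed_Collect_le continuous_intros)
  moreover have "{y \<in> \<Omega>. d x y \<le> r} = {y \<in> E. d x y \<le> r}"
  proof -
    have "y \<in> E" if "y \<in> \<Omega>" "d x y \<le> r" for y
      using D_growth(1)[of y x r] that x commute[of x y]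
      by (simp add: E_def exp_minus field_simps)
    then show ?thesis using E by blast
  qed
  moreover have "bounded {y \<in> \<Omega>. d x y \<le> r}"
    by (rule boundedI[of _ "norm x + D x * (exp (A * r) - 1)"])
       (smt (verit) D_growth(2) x dist_norm mem_Collect_eq norm_triangle_ineq3)
  ultimately show ?thesis by (simp add: compact_eq_bounded_closed)
qed

lemma proper: "proper_metric \<Omega> d"
  unfolding proper_metric_def
proof (intro ballI allI)
  fix x r assume x: "x \<in> \<Omega>"
  \<comment> \<open>Continuity of the identity from the Euclidean to the metric topology transports
    the Euclidean compactness of balls.\<close>
  have "continuous_map (top_of_set \<Omega>) mtopology id"
    unfolding continuous_map_to_metric
  proof (intro ballI allI impI)
    fix y and e :: real
    assume "y \<in> topspace (top_of_set \<Omega>)" "0 < e"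
    then have y: "y \<in> \<Omega>" by simp
    let ?U = "{z \<in> \<Omega>. d y z < e}"
    have "openin (top_of_set \<Omega>) ?U"
      using continuous_openin_preimage_gen[OF continuous_on_d[OF y], of "{..<e}"]
      by (simp add: vimage_def Int_def)
    moreover have "y \<in> ?U" "\<forall>z\<in>?U. id z \<in> mball (id y) e" using y \<open>0 < e\<close> by auto
    ultimately show "\<exists>U. openin (top_of_set \<Omega>) U \<and> y \<in> U \<and> (\<forall>z\<in>U. id z \<in> mball (id y) e)"
      by blast
  qed
  moreover have "compactin (top_of_set \<Omega>) {y \<in> \<Omega>. d x y \<le> r}"
    using compact_ball[OF x, of r] unfolding compactin_subtopology by simp
  ultimately have "compactin mtopology (id ` {y \<in> \<Omega>. d x y \<le> r})"
    by (rule image_compactin[rotated])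
  moreover have "mcball x r = id ` {y \<in> \<Omega>. d x y \<le> r}" using x by auto
  ultimately show "compactin mtopology (mcball x r)" by simp
qed

subsection \<open>Existence of geodesics\<close>

text \<open>Approximate intermediate points with error 1/(n+1) form nested nonempty compact sets,
  and a common point is exact. When \<open>s\<close> exceeds the distance, \<open>y\<close> itself
  serves.\<close>

lemma between:
  assumes x: "x \<in> \<Omega>" and y: "y \<in> \<Omega>" and s: "0 \<le> s" "0 \<le> s'" "d x y \<le> s + s'"
  shows "\<exists>z\<in>\<Omega>. d x z \<le> s \<and> d y z \<le> s'"
proof -
  let ?F = "(\<lambda>n. {z \<in> \<Omega>. d x z \<le> s} \<inter> {z \<in> \<Omega>. d y z \<le> s' + 1 / real (Suc n)}) :: nat \<Rightarrow> 'a set"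
  have "\<Inter>(range ?F) \<noteq> {}"
  proof (rule compact_nest)
    fix n :: nat
    show "compact (?F n)" by (intro compact_Int compact_ball x y)
    show "?F n \<noteq> {}"
    proof (cases "s \<le> d x y")
      case True
      then obtain z where z: "z \<in> \<Omega>" "d x z \<le> s" "d z y \<le> d x y - s + 1 / real (Suc n)"
        using almost_between[OF x y, of "1 / real (Suc n)" s] s by auto
      then have "z \<in> ?F n" using s commute[of z y] by simp
      then show ?thesis by blast
    next
      case False
      then have "y \<in> ?F n" using y s by simp
      then show ?thesis by blast
    qed
    fix m :: nat assume "n \<le> m"
    then have "1 / real (Suc m) \<le> 1 / real (Suc n)" by (simp add: field_simps)
    then show "?F m \<subseteq> ?F n" by auto
  qed
  then obtain z where z: "\<And>n. z \<in> ?F n" by blast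
  have "d y z \<le> s'"
  proof (rule field_le_epsilon)
    fix e :: real assume "0 < e"
    then obtain n where "1 / real (Suc n) < e" using nat_approx_posE by blast
    then show "d y z \<le> s' + e" using z[of n] by auto
  qed
  then show ?thesis using z[of 0] by blast
qed

text \<open>Partial geodesics are handled as their graphs, which are only asked to be 1-Lipschitz: this
  passes to unions of chains, and it forces the isometry property once both endpoints are present.\<close>

definition lip_graph :: "(real \<times> 'a) set \<Rightarrow> bool" where
  "lip_graph S \<longleftrightarrow> (\<forall>s p. (s,p) \<in> S \<longrightarrow> p \<in> \<Omega>) \<and>
     (\<forall>s p t q. (s,p) \<in> S \<longrightarrow> (t,q) \<in> S \<longrightarrow> d p q \<le> \<bar>s - t\<bar>)"

lemma lip_graph_subset: "lip_graph S \<Longrightarrow> T \<subseteq> S \<Longrightarrow> lip_graph T"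
  unfolding lip_graph_def by blast

text \<open>Only the nearest earlier and the nearest later point constrain the new one, and
  \<open>between\<close> fits a point to these two. The triangle inequality passes the bound on to
  all other times.\<close>

lemma lip_graph_extend:
  assumes S: "lip_graph S" "finite S" "S \<noteq> {}"
  shows "\<exists>z\<in>\<Omega>. \<forall>(s,p)\<in>S. d p z \<le> \<bar>s - t\<bar>"
proof -
  have lip: "d p q \<le> \<bar>s - u\<bar>" and inn: "p \<in> \<Omega>" if "(s,p) \<in> S" "(u,q) \<in> S" for s p u q
    using S(1) that unfolding lip_graph_def by blast+
  let ?L = "{x \<in> S. fst x \<le> t}" and ?R = "{x \<in> S. t \<le> fst x}"
  have L: "\<exists>s p. (s,p) \<in> ?L \<and> (\<forall>(u,q)\<in>?L. u \<le> s)" if "?L \<noteq> {}"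
  proof -
    have fin: "finite (fst ` ?L)" using S(2) by simp
    then have "Max (fst ` ?L) \<in> fst ` ?L" using that by (intro Max_in) simp_all
    then obtain s p where "(s,p) \<in> ?L" "s = Max (fst ` ?L)" by auto
    moreover have "fst z \<le> Max (fst ` ?L)" if "z \<in> ?L" for z
      using Max_ge[OF fin imageI[OF that]] .
    ultimately show ?thesis
      by (intro exI[of _ s] exI[of _ p]) auto
  qed
  have R: "\<exists>s p. (s,p) \<in> ?R \<and> (\<forall>(u,q)\<in>?R. s \<le> u)" if "?R \<noteq> {}"
  proof -
    have fin: "finite (fst ` ?R)" using S(2) by simp
    then have "Min (fst ` ?R) \<in> fst ` ?R" using that by (intro Min_in) simp_all
    then obtain s p where "(s,p) \<in> ?R" "s = Min (fst ` ?R)" by auto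
    moreover have "Min (fst ` ?R) \<le> fst z" if "z \<in> ?R" for z
      using Min_le[OF fin imageI[OF that]] .
    ultimately show ?thesis
      by (intro exI[of _ s] exI[of _ p]) auto
  qed
  consider "?L = {}" "?R = {}" | "?L = {}" "?R \<noteq> {}" | "?L \<noteq> {}" "?R = {}"
    | "?L \<noteq> {}" "?R \<noteq> {}" by blast
  then show ?thesis
  proof cases
    case 1
    have "(u,q) \<notin> S" for u q using 1 by (cases "u \<le> t") auto
    then show ?thesis using S(3) by auto
  next
    case 2
    then obtain s p where sp: "(s,p) \<in> ?R" "\<forall>(u,q)\<in>?R. s \<le> u" using R by blast
    have "d q p \<le> \<bar>u - t\<bar>" if "(u,q) \<in> S" for u q
    proof -
      have "(u,q) \<in> ?R" using 2 that by (cases "u \<le> t") auto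
      then have "s \<le> u" "t \<le> s" using sp by auto
      then show ?thesis using lip[OF that, of s p] sp by simp
    qed
    then show ?thesis using sp inn by blast
  next
    case 3
    then obtain s p where sp: "(s,p) \<in> ?L" "\<forall>(u,q)\<in>?L. u \<le> s" using L by blast
    have "d q p \<le> \<bar>u - t\<bar>" if "(u,q) \<in> S" for u q
    proof -
      have "(u,q) \<in> ?L" using 3 that by (cases "u \<le> t") auto
      then have "u \<le> s" "s \<le> t" using sp by auto
      then show ?thesis using lip[OF that, of s p] sp by simp
    qed
    then show ?thesis using sp inn by blast
  next
    case 4
    then obtain s p s' p' where sp: "(s,p) \<in> ?L" "\<forall>(u,q)\<in>?L. u \<le> s"
      and sp': "(s',p') \<in> ?R" "\<forall>(u,q)\<in>?R. s' \<le> u" using L R by meson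
    have pp': "p \<in> \<Omega>" "p' \<in> \<Omega>" "s \<le> t" "t \<le> s'" using sp sp' inn by auto
    moreover have "d p p' \<le> (t - s) + (s' - t)" using lip[of s p s' p'] sp sp' by simp
    ultimately obtain z where z: "z \<in> \<Omega>" "d p z \<le> t - s" "d p' z \<le> s' - t"
      using between[of p p' "t - s" "s' - t"] by auto
    have "d q z \<le> \<bar>u - t\<bar>" if "(u,q) \<in> S" for u q
    proof (cases "u \<le> t")
      case True
      then have "(u,q) \<in> ?L" using that by simp
      then have "u \<le> s" using sp(2) by auto
      then have "d q p \<le> s - u" using lip[OF that, of s p] sp by simp
      then show ?thesis using triangle[of q p z] z inn[OF that that] pp' True by linarith
    next
      case False
      then have "(u,q) \<in> ?R" using that by simp
      then have "s' \<le> u" using sp'(2) by auto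
      then have "d q p' \<le> u - s'" using lip[OF that, of s' p'] sp' by simp
      then show ?thesis using triangle[of q p' z] z inn[OF that that] pp' False by linarith
    qed
    then show ?thesis using z(1) by blast
  qed
qed

lemma geodesic: "geodesic_metric \<Omega> d"
  unfolding geodesic_metric_def
proof (intro ballI)
  fix x y assume x: "x \<in> \<Omega>" and y: "y \<in> \<Omega>"
  define L where "L = d x y"
  let ?S0 = "{(0, x), (L, y)}"
  let ?F = "{S. lip_graph S \<and> ?S0 \<subseteq> S}"
  have S0: "?S0 \<in> ?F"
    using x y commute[of x y] nonneg[of x y] by (auto simp: lip_graph_def L_def)
  have "\<exists>M\<in>?F. \<forall>X\<in>?F. M \<subseteq> X \<longrightarrow> X = M"
  proof (rule subset_Zorn_nonempty)
    show "?F \<noteq> {}" using S0 by blast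
    fix K assume K: "K \<noteq> {}" "subset.chain ?F K"
    have "lip_graph (\<Union>K)"
      unfolding lip_graph_def
    proof (intro conjI allI impI)
      fix s p assume "(s,p) \<in> \<Union>K"
      then show "p \<in> \<Omega>" using K(2) by (auto simp: subset.chain_def lip_graph_def)
      fix t q assume "(t,q) \<in> \<Union>K"
      with \<open>(s,p) \<in> \<Union>K\<close> obtain P Q where PQ: "P \<in> K" "Q \<in> K" "(s,p) \<in> P" "(t,q) \<in> Q"
        by blast
      then have "P \<subseteq> Q \<or> Q \<subseteq> P" using K(2) by (auto simp: subset.chain_def)
      then obtain R where "R \<in> K" "(s,p) \<in> R" "(t,q) \<in> R" using PQ by blast
      moreover have "lip_graph R" using K(2) \<open>R \<in> K\<close> by (auto simp: subset.chain_def)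
      ultimately show "d p q \<le> \<bar>s - t\<bar>" unfolding lip_graph_def by blast
    qed
    moreover have "?S0 \<subseteq> \<Union>K" using K by (auto simp: subset.chain_def)
    ultimately show "\<Union>K \<in> ?F" by blast
  qed
  then obtain M where "M \<in> ?F" and max': "\<forall>X\<in>?F. M \<subseteq> X \<longrightarrow> X = M" by (elim bexE)
  then have M: "lip_graph M" "?S0 \<subseteq> M" by simp_all
  have max: "X = M" if "lip_graph X" "M \<subseteq> X" for X
  proof -
    have "X \<in> ?F" using that M(2) by blast
    then show ?thesis using max' that(2) by (metis (lifting))
  qed
  have lip: "d p q \<le> \<bar>s - t\<bar>" and inn: "p \<in> \<Omega>" if "(s,p) \<in> M" "(t,q) \<in> M" for s p t q
    using M(1) that unfolding lip_graph_def by blast+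
  \<comment> \<open>The admissible positions at time \<open>t\<close> form compact balls with the
    finite intersection property, by the finite extension lemma. Adding \<open>(0,x)\<close> keeps
    each finite subgraph nonempty. Maximality of \<open>M\<close> then absorbs the common
    point.\<close>
  have total: "\<exists>z. (t,z) \<in> M" for t
  proof -
    let ?B = "\<lambda>(s,p). {z \<in> \<Omega>. d p z \<le> \<bar>s - t\<bar>}"
    have "\<Inter>(?B ` M) \<noteq> {}"
    proof (rule compact_fip_Heine_Borel)
      show "compact T" if "T \<in> ?B ` M" for T
        using that compact_ball inn by fastforce
      show "\<Inter>G \<noteq> {}" if G: "finite G" "G \<subseteq> ?B ` M" for G
      proof -
        obtain N where N: "N \<subseteq> M" "finite N" "G = ?B ` N"
          using finite_subset_image[OF G] by blast
        let ?N = "insert (0,x) N"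
        have "?N \<subseteq> M" using N M(2) by blast
        then have "lip_graph ?N" by (rule lip_graph_subset[OF M(1)])
        then have "\<exists>z\<in>\<Omega>. \<forall>(s,p)\<in>?N. d p z \<le> \<bar>s - t\<bar>"
          by (rule lip_graph_extend) (simp_all add: N(2))
        then obtain z where "z \<in> \<Omega>" "\<forall>(s,p)\<in>?N. d p z \<le> \<bar>s - t\<bar>" by (elim bexE)
        then have "z \<in> \<Inter>G" using N by auto
        then show ?thesis by blast
      qed
    qed
    then obtain z where "z \<in> \<Inter>(?B ` M)" by blast
    then have z: "z \<in> \<Omega> \<and> d p z \<le> \<bar>s - t\<bar>" if "(s,p) \<in> M" for s p
      using that by blast
    have "lip_graph (insert (t,z) M)"
      unfolding lip_graph_def
    proof (intro conjI allI impI)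
      have "z \<in> \<Omega>" using z M(2) by blast
      fix s p assume sp: "(s,p) \<in> insert (t,z) M"
      then show "p \<in> \<Omega>" using \<open>z \<in> \<Omega>\<close> inn by blast
      fix u q assume "(u,q) \<in> insert (t,z) M"
      then show "d p q \<le> \<bar>s - u\<bar>"
        using sp \<open>z \<in> \<Omega>\<close> z[of s p] z[of u q] lip[of s p u q] commute[of z q]
        by (auto simp: abs_minus_commute)
    qed
    then show ?thesis using max by blast
  qed
  \<comment> \<open>Prescribing the ends secures the endpoint conditions; when \<open>L = 0\<close>
    the first clause applies and \<open>x = y\<close>.\<close>
  define c where "c t = (if t = 0 then x else if t = L then y else SOME z. (t,z) \<in> M)" for t
  have cM: "(t, c t) \<in> M" for t
    using M(2) someI_ex[OF total[of t]] by (auto simp: c_def)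
  have c0: "c 0 = x" by (simp add: c_def)
  have cL: "c L = y" using x y zero[OF x y] by (auto simp: c_def L_def)
  have "d (c s) (c t) = \<bar>s - t\<bar>" if st: "s \<in> {0..L}" "t \<in> {0..L}" for s t
  proof -
    \<comment> \<open>The ends are exactly \<open>L\<close> apart, so the triangle inequality leaves
      no slack in the Lipschitz bounds.\<close>
    have *: "t - s \<le> d (c s) (c t)" if "s \<in> {0..L}" "t \<in> {0..L}" for s t
    proof -
      have "d x y \<le> d x (c s) + (d (c s) (c t) + d (c t) y)"
        using triangle[of x "c s" y] triangle[of "c s" "c t" y] x y inn[OF cM cM] by fastforce
      moreover have "d x (c s) \<le> s" "d (c t) y \<le> L - t"
        using lip[OF cM[of 0] cM[of s]] lip[OF cM[of t] cM[of L]] that c0 cL by auto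
      ultimately show ?thesis by (simp add: L_def)
    qed
    show ?thesis using *[OF st] *[OF st(2,1)] lip[OF cM[of s] cM[of t]] commute[of "c s" "c t"]
      by linarith
  qed
  then have "geodesic_segment \<Omega> d x y (c ` {0..L})"
    unfolding geodesic_segment_def using c0 cL inn[OF cM cM] nonneg[of x y]
    by (intro exI[of _ c] exI[of _ L]) (auto simp: L_def)
  then show "\<exists>S. geodesic_segment \<Omega> d x y S" by blast
qed

subsection \<open>Geodesics are uniform curves\<close>

definition geod :: "(real \<Rightarrow> 'a) \<Rightarrow> real \<Rightarrow> bool" where
  "geod c T \<longleftrightarrow> 0 \<le> T \<and> c ` {0..T} \<subseteq> \<Omega> \<and>
     (\<forall>s\<in>{0..T}. \<forall>t\<in>{0..T}. d (c s) (c t) = \<bar>s - t\<bar>)"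

lemma geodesic_segment_iff:
  "geodesic_segment \<Omega> d x y S \<longleftrightarrow> (\<exists>c T. geod c T \<and> c 0 = x \<and> c T = y \<and> S = c ` {0..T})"
  unfolding geodesic_segment_def geod_def by blast

lemma geod_reverse: "geod c T \<Longrightarrow> geod (\<lambda>t. c (T - t)) T"
  unfolding geod_def by (auto simp: image_subset_iff)

lemma geod_restrict: "geod c T \<Longrightarrow> 0 \<le> t \<Longrightarrow> t \<le> T \<Longrightarrow> geod c t"
  unfolding geod_def by (auto simp: image_subset_iff)

lemma geodesic_segment_commute:
  assumes "geodesic_segment \<Omega> d x y S" shows "geodesic_segment \<Omega> d y x S"
proof -
  obtain c T where c: "geod c T" "c 0 = x" "c T = y" "S = c ` {0..T}"
    using assms unfolding geodesic_segment_iff by (elim exE conjE)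
  have "(\<lambda>t. c (T - t)) ` {0..T} = c ` ((\<lambda>t. T - t) ` {0..T})" by (rule image_image[symmetric])
  also have "(\<lambda>t. T - t) ` {0..T} = {0..T}" by simp
  finally show ?thesis
    unfolding geodesic_segment_iff using geod_reverse[OF c(1)] c(2-4)
    by (intro exI[of _ "\<lambda>t. c (T - t)"] exI[of _ T]) simp
qed

lemma geodesic_segment_memb:
  assumes "geodesic_segment \<Omega> d x y S" shows "S \<subseteq> \<Omega>" "x \<in> S" "y \<in> S"
proof -
  obtain c T where "geod c T" "c 0 = x" "c T = y" "S = c ` {0..T}"
    using assms unfolding geodesic_segment_iff by (elim exE conjE)
  then show "S \<subseteq> \<Omega>" "x \<in> S" "y \<in> S" by (auto simp: geod_def)
qed

lemma geod_growth:
  assumes "geod c T" "s \<in> {0..T}" "t \<in> {0..T}" "\<bar>s - t\<bar> \<le> r"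
  shows "D (c t) \<le> D (c s) * exp (A * r)" and "dist (c s) (c t) \<le> D (c s) * (exp (A * r) - 1)"
  using assms D_growth[of "c s" "c t" r] by (auto simp: geod_def image_subset_iff)

lemma geod_continuous:
  assumes c: "geod c T" shows "continuous_on {0..T} c"
  unfolding continuous_on_def
proof
  fix s assume s: "s \<in> {0..T}"
  have "((\<lambda>t. D (c s) * (exp (A * \<bar>s - t\<bar>) - 1)) \<longlongrightarrow> D (c s) * (exp (A * \<bar>s - s\<bar>) - 1)) (at s within {0..T})"
    by (intro tendsto_intros)
  then have "((\<lambda>t. D (c s) * (exp (A * \<bar>s - t\<bar>) - 1)) \<longlongrightarrow> 0) (at s within {0..T})" by simp
  moreover have "\<forall>\<^sub>F t in at s within {0..T}.
      norm (dist (c t) (c s)) \<le> D (c s) * (exp (A * \<bar>s - t\<bar>) - 1)"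
    unfolding eventually_at_filter
    using geod_growth(2)[OF c s _ order_refl] by (intro always_eventually) (auto simp: dist_commute)
  ultimately have "((\<lambda>t. dist (c t) (c s)) \<longlongrightarrow> 0) (at s within {0..T})"
    by (rule Lim_null_comparison[rotated])
  then show "(c \<longlongrightarrow> c s) (at s within {0..T})" by (rule tendsto_dist_iff[THEN iffD2])
qed

lemma geod_continuous_D:
  assumes "geod c T" "{a..b} \<subseteq> {0..T}" shows "continuous_on {a..b} (\<lambda>t. D (c t))"
  using continuous_on_subset[OF geod_continuous[OF assms(1)] assms(2)]
  by (intro continuous_intros)

lemma geod_in: "geod c T \<Longrightarrow> t \<in> {0..T} \<Longrightarrow> c t \<in> \<Omega>"
  by (auto simp: geod_def)

lemma geod_dist: "geod c T \<Longrightarrow> s \<in> {0..T} \<Longrightarrow> t \<in> {0..T} \<Longrightarrow> d (c s) (c t) = \<bar>s - t\<bar>"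
  by (auto simp: geod_def)

text \<open>Cutting into unit times makes the displacement linear in time, whereas
  \<open>geod_growth\<close> applied once would give an exponential.\<close>

lemma geod_displacement:
  assumes c: "geod c T" and "0 \<le> a" and "b \<le> T" and m: "\<And>u. u \<in> {a..b} \<Longrightarrow> D (c u) \<le> m"
    and "a \<le> b" "b - a \<le> real n"
  shows "dist (c a) (c b) \<le> m * (exp A - 1) * real n"
  using assms(3-6)
proof (induction n arbitrary: b)
  case 0
  then show ?case by simp
next
  case (Suc n)
  \<comment> \<open>The start of the last unit step; the maximum covers a remaining time shorter
    than 1.\<close>
  let ?b = "max a (b - 1)"
  have "0 \<le> D (c a)" by (rule infdist_nonneg)
  also have "D (c a) \<le> m" using Suc.prems(3) by (intro Suc.prems(2)) simp
  finally have "0 \<le> m" .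
  have "dist (c a) (c ?b) \<le> m * (exp A - 1) * real n"
    using Suc.prems by (intro Suc.IH) auto
  moreover have "dist (c ?b) (c b) \<le> D (c ?b) * (exp (A * 1) - 1)"
    using Suc.prems assms(2) by (intro geod_growth(2)[OF c]) auto
  moreover have "D (c ?b) * (exp (A * 1) - 1) \<le> m * (exp A - 1)"
    using Suc.prems A_pos by (intro mult_mono) (auto simp: infdist_nonneg \<open>0 \<le> m\<close>)
  ultimately show ?case
    using dist_triangle[of "c a" "c b" "c ?b"] by (simp add: algebra_simps)
qed

text \<open>A geodesic cannot linger at one scale of the distance to the boundary: over time
  \<open>T\<close> it covers a Euclidean distance \<open>O(T)\<close> at that scale, which has \<open>d\<close>-length \<open>O(log T)\<close>.\<close>

lemma scale_time_bounded:
  obtains l where "0 < l"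
    "\<And>c T a b m. \<lbrakk>geod c T; 0 \<le> a; a \<le> b; b \<le> T; m \<le> D (c a); m \<le> D (c b); 0 < m;
       \<And>u. u \<in> {a..b} \<Longrightarrow> D (c u) \<le> 2 * m\<rbrakk> \<Longrightarrow> b - a \<le> l"
proof -
  define E where "E = exp A - 1"
  have "0 < E" using A_pos by (simp add: E_def)
  \<comment> \<open>An explicit bound for the solutions x of x <= B + B * ln (1 + 2 * E * (x + 1)),
    made positive by the absolute value and the final 1.\<close>
  define l where "l = \<bar>2 * (B * ln (4 * B * E)) + 1 / (2 * E) + 1\<bar> + 1"
  show ?thesis
  proof (rule that)
    show "0 < l" by (simp add: l_def)
    fix c T a b m
    assume c: "geod c T" and ab: "0 \<le> a" "a \<le> b" "b \<le> T"
      and m: "m \<le> D (c a)" "m \<le> D (c b)" "0 < m" and le: "\<And>u. u \<in> {a..b} \<Longrightarrow> D (c u) \<le> 2 * m"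
    define x where "x = b - a"
    have "0 \<le> x" using ab by (simp add: x_def)
    have "dist (c a) (c b) \<le> 2 * m * (exp A - 1) * real (nat \<lceil>x\<rceil>)"
      using ab le by (intro geod_displacement[OF c]) (auto simp: x_def real_nat_ceiling_ge)
    also have "\<dots> \<le> 2 * m * E * (x + 1)"
      unfolding E_def using m \<open>0 < E\<close> \<open>0 \<le> x\<close> by (intro mult_left_mono) (auto simp: E_def)
    finally have "dist (c a) (c b) \<le> 2 * E * (x + 1) * m" by (simp add: mult_ac)
    also have "\<dots> \<le> 2 * E * (x + 1) * min (D (c a)) (D (c b))"
      using m \<open>0 < E\<close> \<open>0 \<le> x\<close> by (intro mult_left_mono) auto
    finally have "dist (c a) (c b) / min (D (c a)) (D (c b)) \<le> 2 * E * (x + 1)"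
      using m by (intro divide_le_eq[THEN iffD2]) auto
    moreover have "0 \<le> dist (c a) (c b) / min (D (c a)) (D (c b))"
      by (intro divide_nonneg_nonneg) (auto simp: infdist_nonneg)
    ultimately have "ln (1 + dist (c a) (c b) / min (D (c a)) (D (c b))) \<le> ln (1 + 2 * E * (x + 1))"
      by (subst ln_le_cancel_iff) auto
    moreover have "x \<le> B + B * ln (1 + dist (c a) (c b) / min (D (c a)) (D (c b)))"
      using upper[of "c a" "c b"] c ab by (auto simp: x_def geod_in geod_dist)
    ultimately have "x \<le> B + B * ln (1 + 2 * E * (x + 1))"
      using B_pos by (smt (verit) mult_left_mono)
    \<comment> \<open>The tangent bound ln u <= ln v + u/v - 1 at v = 4 * B * E: after
      multiplication by \<open>B\<close> its linear term is x/2, which the left side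
      absorbs.\<close>
    moreover have "ln (1 + 2 * E * (x + 1)) \<le> ln (4 * B * E) + (1 + 2 * E * (x + 1)) / (4 * B * E) - 1"
    proof -
      have "0 < 1 + 2 * E * (x + 1)" "0 < 4 * B * E"
        using \<open>0 < E\<close> \<open>0 \<le> x\<close> B_pos by (auto intro!: add_pos_nonneg)
      then show ?thesis
        using ln_le_minus_one[of "(1 + 2 * E * (x + 1)) / (4 * B * E)"]
          ln_div[of "1 + 2 * E * (x + 1)" "4 * B * E"] by (auto simp: zero_less_mult_iff)
    qed
    ultimately have "x \<le> B + B * (ln (4 * B * E) + (1 + 2 * E * (x + 1)) / (4 * B * E) - 1)"
      using B_pos by (smt (verit) mult_left_mono)
    also have "\<dots> = B * ln (4 * B * E) + 1 / (4 * E) + (x + 1) / 2"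
      using B_pos \<open>0 < E\<close> by (simp add: field_simps)
    finally have "x \<le> 2 * (B * ln (4 * B * E)) + 1 / (2 * E) + 1"
      using \<open>0 < E\<close> by (simp add: field_simps)
    then show "b - a \<le> l" unfolding l_def x_def by linarith
  qed
qed

text \<open>Going back in time from the highest point before \<open>t\<close>, each halving of the
  height takes time at most \<open>l\<close> by \<open>scale_time_bounded\<close>. The displacements
  at successive scales then sum like a geometric series, giving \<open>far\<close>. By
  \<open>peak\<close> the height at \<open>t\<close> is comparable to that maximum.\<close>

lemma half_cone:
  obtains K where "1 \<le> K"
    "\<And>c T t. \<lbrakk>geod c T; \<And>u. u \<in> {0..T} \<Longrightarrow> D (c u) \<le> D (c T); t \<in> {0..T}\<rbrakk>
       \<Longrightarrow> dist (c 0) (c t) \<le> K * D (c t)"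
proof -
  obtain l where "0 < l" and l: "\<And>c T a b m. \<lbrakk>geod c T; 0 \<le> a; a \<le> b; b \<le> T; m \<le> D (c a); m \<le> D (c b); 0 < m;
       \<And>u. u \<in> {a..b} \<Longrightarrow> D (c u) \<le> 2 * m\<rbrakk> \<Longrightarrow> b - a \<le> l"
    using scale_time_bounded by blast
  \<comment> \<open>The time \<open>2 * l\<close> allows \<open>l\<close> for one halving and
    \<open>l\<close> for the delay between the highest point and the current time.\<close>
  define E where "E = exp (A * (2 * l))"
  have "1 \<le> E" using A_pos \<open>0 < l\<close> by (simp add: E_def)
  show ?thesis
  proof (rule that[of "E * exp (A * l)"])
    show "1 \<le> E * exp (A * l)"
      using \<open>1 \<le> E\<close> A_pos \<open>0 < l\<close> mult_mono[of 1 E 1 "exp (A * l)"] by simp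
    fix c T t
    assume c: "geod c T" and top: "\<And>u. u \<in> {0..T} \<Longrightarrow> D (c u) \<le> D (c T)" and t: "t \<in> {0..T}"
    have pos: "0 < D (c u)" if "u \<in> {0..T}" for u using D_pos geod_in[OF c that] .
    \<comment> \<open>The end of the geodesic is its highest point, so after \<open>s\<close> the
      height returns to its earlier maximum at some \<open>b\<close>. From \<open>a\<close> to
      \<open>b\<close> the geodesic stays at one scale.\<close>
    have peak: "s - a \<le> l"
      if s: "s \<in> {0..T}" and a: "a \<in> {0..s}" and m: "\<And>u. u \<in> {0..s} \<Longrightarrow> D (c u) \<le> D (c a)" for s a
    proof -
      obtain b where b: "b \<in> {s..T}" "D (c b) = D (c a)" "\<And>u. u \<in> {s..b} \<Longrightarrow> D (c u) \<le> D (c a)"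
        using first_time_at_level[of s T "\<lambda>t. D (c t)" "D (c a)"] geod_continuous_D[OF c, of s T]
          s a m[of s] top[of a] by auto
      have "D (c u) \<le> 2 * D (c a)" if "u \<in> {a..b}" for u
        using m[of u] b(3)[of u] pos[of u] that a s b(1) by (cases "u \<le> s") auto
      then have "b - a \<le> l"
        using a s b pos[of a] by (intro l[OF c, of a b "D (c a)"]) auto
      then show ?thesis using b by simp
    qed
    \<comment> \<open>The exponent \<open>n\<close> bounds the number of halvings down to the
      initial height. It drives the induction, while the bound itself does not depend on it.\<close>
    have far: "dist (c 0) (c s) \<le> E * D (c a)"
      if "s \<in> {0..T}" "a \<in> {0..s}" "\<And>u. u \<in> {0..s} \<Longrightarrow> D (c u) \<le> D (c a)" "D (c a) \<le> 2 ^ n * D (c 0)"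
      for n s a
      using that
    proof (induction n arbitrary: s a rule: less_induct)
      case (less n)
      note sa = peak[OF less.prems(1-3)]
      have aT: "a \<in> {0..T}" using less.prems by auto
      have le2: "D (c u) \<le> 2 * (D (c a) / 2)" if "u \<in> {0..a}" for u
        using less.prems(2,3) that by auto
      show ?case
      proof (cases "D (c a) / 2 \<le> D (c 0)")
        case True
        have "a - 0 \<le> l"
          using True pos[OF aT] less.prems le2 by (intro l[OF c, of 0 a "D (c a) / 2"]) auto
        then have "dist (c 0) (c s) \<le> D (c 0) * (E - 1)"
          unfolding E_def using less.prems sa by (intro geod_growth(2)[OF c]) auto
        also have "\<dots> \<le> D (c a) * E"
          using less.prems(1,2) less.prems(3)[of 0] \<open>1 \<le> E\<close> pos[OF aT] by (intro mult_mono) auto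
        finally show ?thesis by (simp add: mult.commute)
      next
        case False
        then have "n \<noteq> 0" using less.prems pos[OF aT] by (intro notI) simp
        then obtain k where k: "n = Suc k" by (cases n) auto
        obtain b where b: "b \<in> {0..a}" "D (c b) = D (c a) / 2" "\<And>u. u \<in> {0..b} \<Longrightarrow> D (c u) \<le> D (c a) / 2"
          using first_time_at_level[of 0 a "\<lambda>t. D (c t)" "D (c a) / 2"] geod_continuous_D[OF c, of 0 a]
            False less.prems aT pos[OF aT] by auto
        have "a - b \<le> l"
          using b pos[OF aT] less.prems le2 by (intro l[OF c, of b a "D (c a) / 2"]) auto
        then have "dist (c b) (c s) \<le> D (c b) * (E - 1)"
          unfolding E_def using less.prems sa b by (intro geod_growth(2)[OF c]) auto
        moreover have "dist (c 0) (c b) \<le> E * D (c b)"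
        proof (rule less.IH[of k])
          show "D (c u) \<le> D (c b)" if "u \<in> {0..b}" for u using b(2) b(3)[OF that] by simp
        qed (use less.prems(1,2,4) b(1,2) k in auto)
        \<comment> \<open>The series closes because 2 * E - 1 times half the height is at most
          \<open>E\<close> times the height.\<close>
        ultimately have "dist (c 0) (c s) \<le> E * D (c b) + D (c b) * (E - 1)"
          using dist_triangle[of "c 0" "c s" "c b"] by linarith
        also have "\<dots> \<le> E * D (c a)" using b(2) pos[OF aT] by (simp add: algebra_simps)
        finally show ?thesis .
      qed
    qed
    have "\<exists>a\<in>{0..t}. \<forall>u\<in>{0..t}. D (c u) \<le> D (c a)"
      using t geod_continuous_D[OF c, of 0 t] by (intro continuous_attains_sup) auto
    then obtain a where a: "a \<in> {0..t}" "\<And>u. u \<in> {0..t} \<Longrightarrow> D (c u) \<le> D (c a)" by blast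
    have "0 < D (c 0)" using pos t by simp
    obtain n :: nat where "D (c a) / D (c 0) < 2 ^ n" using real_arch_pow[of 2] by auto
    then have "D (c a) \<le> 2 ^ n * D (c 0)" using \<open>0 < D (c 0)\<close> by (simp add: field_simps)
    then have "dist (c 0) (c t) \<le> E * D (c a)" using far t a by blast
    also have "D (c a) \<le> D (c t) * exp (A * l)"
      using peak[OF t a] t a(1) by (intro geod_growth(1)[OF c]) auto
    finally show "dist (c 0) (c t) \<le> E * exp (A * l) * D (c t)"
      using \<open>1 \<le> E\<close> by (simp add: mult_ac)
  qed
qed

text \<open>Cut at the highest point: \<open>half_cone\<close> applies to the first part and to the
  reversal of the second.\<close>

lemma cone:
  obtains K where "1 \<le> K"
    "\<And>c T. geod c T \<Longrightarrow> \<exists>t\<^sub>0\<in>{0..T}. (\<forall>u\<in>{0..T}. D (c u) \<le> D (c t\<^sub>0)) \<and>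
       (\<forall>t\<in>{0..t\<^sub>0}. dist (c 0) (c t) \<le> K * D (c t)) \<and>
       (\<forall>t\<in>{t\<^sub>0..T}. dist (c T) (c t) \<le> K * D (c t))"
proof -
  obtain K where K: "1 \<le> K" "\<And>c T t. \<lbrakk>geod c T; \<And>u. u \<in> {0..T} \<Longrightarrow> D (c u) \<le> D (c T); t \<in> {0..T}\<rbrakk>
       \<Longrightarrow> dist (c 0) (c t) \<le> K * D (c t)"
    using half_cone by blast
  show ?thesis
  proof (rule that[OF K(1)])
    fix c T assume c: "geod c T"
    then have "\<exists>t\<in>{0..T}. \<forall>u\<in>{0..T}. D (c u) \<le> D (c t)"
      using geod_continuous_D[OF c, of 0 T] by (intro continuous_attains_sup) (auto simp: geod_def)
    then obtain t0 where t0: "t0 \<in> {0..T}" "\<And>u. u \<in> {0..T} \<Longrightarrow> D (c u) \<le> D (c t0)" by blast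
    have "dist (c 0) (c t) \<le> K * D (c t)" if "t \<in> {0..t0}" for t
      using that t0 by (intro K(2)[OF geod_restrict[OF c, of t0]]) auto
    moreover have "dist (c T) (c t) \<le> K * D (c t)" if "t \<in> {t0..T}" for t
      using that t0 K(2)[OF geod_restrict[OF geod_reverse[OF c], of "T - t0"], of "T - t"] by auto
    ultimately show "\<exists>t\<^sub>0\<in>{0..T}. (\<forall>u\<in>{0..T}. D (c u) \<le> D (c t\<^sub>0)) \<and>
       (\<forall>t\<in>{0..t\<^sub>0}. dist (c 0) (c t) \<le> K * D (c t)) \<and>
       (\<forall>t\<in>{t\<^sub>0..T}. dist (c T) (c t) \<le> K * D (c t))" using t0 by blast
  qed
qed

lemma upper_scaled:
  assumes "x \<in> \<Omega>" "y \<in> \<Omega>" "0 < s" "s \<le> D x" "s \<le> D y" "dist x y \<le> k * s"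
  shows "d x y \<le> B + B * ln (1 + k)"
proof -
  have "dist x y / min (D x) (D y) \<le> dist x y / s"
    using assms by (intro divide_left_mono) auto
  also have "\<dots> \<le> k" using assms by (simp add: field_simps)
  finally have *: "dist x y / min (D x) (D y) \<le> k" .
  moreover have "0 \<le> dist x y / min (D x) (D y)" using assms by (intro divide_nonneg_nonneg) auto
  ultimately have "ln (1 + dist x y / min (D x) (D y)) \<le> ln (1 + k)" by simp
  then show ?thesis using upper[OF assms(1,2)] B_pos by (smt (verit) mult_left_mono)
qed

text \<open>If the top exceeds the scale S of the end data, the geodesic has height S at times
  \<open>a\<close> and \<open>b\<close> on either side of it. The cone bounds place these points
  within \<open>K * S\<close> of the ends, so the excursion lasts at most \<open>l\<close> and
  multiplies the height by at most a constant.\<close>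

lemma geodesic_cone_and_height:
  obtains K where "1 \<le> K"
    "\<And>c T t. \<lbrakk>geod c T; t \<in> {0..T}\<rbrakk>
       \<Longrightarrow> dist (c 0) (c t) \<le> K * D (c t) \<or> dist (c T) (c t) \<le> K * D (c t)"
    "\<And>c T t. \<lbrakk>geod c T; t \<in> {0..T}\<rbrakk>
       \<Longrightarrow> D (c t) \<le> K * max (dist (c 0) (c T)) (max (D (c 0)) (D (c T)))"
proof -
  obtain K where K1: "1 \<le> K" and K: "\<And>c T. geod c T \<Longrightarrow> \<exists>t\<^sub>0\<in>{0..T}. (\<forall>u\<in>{0..T}. D (c u) \<le> D (c t\<^sub>0)) \<and>
       (\<forall>t\<in>{0..t\<^sub>0}. dist (c 0) (c t) \<le> K * D (c t)) \<and>
       (\<forall>t\<in>{t\<^sub>0..T}. dist (c T) (c t) \<le> K * D (c t))" using cone by blast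
  \<comment> \<open>The factor \<open>2 * K + 1\<close> adds the two cone bounds at height S and the
    distance of the ends.\<close>
  define l where "l = B + B * ln (1 + (2 * K + 1))"
  define H where "H = max K (exp (A * l))"
  show ?thesis
  proof (rule that)
    show "1 \<le> H" using K1 by (simp add: H_def)
    fix c T t assume c: "geod c T" and t: "t \<in> {0..T}"
    obtain t0 where t0: "t0 \<in> {0..T}" "\<And>u. u \<in> {0..T} \<Longrightarrow> D (c u) \<le> D (c t0)"
      "\<And>t. t \<in> {0..t0} \<Longrightarrow> dist (c 0) (c t) \<le> K * D (c t)"
      "\<And>t. t \<in> {t0..T} \<Longrightarrow> dist (c T) (c t) \<le> K * D (c t)" using K[OF c] by blast
    have "K * D (c t) \<le> H * D (c t)"
      by (intro mult_right_mono) (auto simp: H_def infdist_nonneg)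
    then show "dist (c 0) (c t) \<le> H * D (c t) \<or> dist (c T) (c t) \<le> H * D (c t)"
      using t0(3,4)[of t] t by (cases "t \<le> t0") auto
    define S where "S = max (dist (c 0) (c T)) (max (D (c 0)) (D (c T)))"
    have S: "dist (c 0) (c T) \<le> S" "D (c 0) \<le> S" "D (c T) \<le> S" by (auto simp: S_def)
    have "0 < S" using S(2) D_pos[OF geod_in[OF c, of 0]] c by (auto simp: geod_def)
    have "D (c t0) \<le> H * S"
    proof (cases "D (c t0) \<le> S")
      case True
      have "S \<le> H * S" using \<open>0 < S\<close> K1 by (simp add: H_def)
      then show ?thesis using True by linarith
    next
      case False
      obtain a where a: "a \<in> {0..t0}" "D (c a) = S"
        using first_time_at_level[of 0 t0 "\<lambda>t. D (c t)" S] geod_continuous_D[OF c, of 0 t0]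
          False S t0(1) by auto
      have "\<exists>x\<ge>t0. x \<le> T \<and> D (c x) = S"
        using False S(3) t0(1) geod_continuous_D[OF c, of t0 T] by (intro IVT2') auto
      then obtain b where b: "b \<in> {t0..T}" "D (c b) = S" by auto
      have "dist (c a) (c b) \<le> dist (c 0) (c a) + dist (c 0) (c T) + dist (c T) (c b)"
        using dist_triangle[of "c a" "c b" "c 0"] dist_triangle[of "c 0" "c b" "c T"]
        by (simp add: dist_commute)
      also have "\<dots> \<le> (2 * K + 1) * S" using t0(3)[OF a(1)] t0(4)[OF b(1)] a b S by (simp add: algebra_simps)
      finally have "d (c a) (c b) \<le> l" unfolding l_def
        using a b t0(1) \<open>0 < S\<close> by (intro upper_scaled[of _ _ S] geod_in[OF c]) auto
      then have "\<bar>a - b\<bar> \<le> l" using geod_dist[OF c, of a b] a b t0(1) by simp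
      then have "D (c t0) \<le> D (c a) * exp (A * l)"
        using a b t0(1) by (intro geod_growth(1)[OF c]) auto
      also have "\<dots> \<le> H * S" using a(2) \<open>0 < S\<close> by (simp add: H_def mult.commute)
      finally show ?thesis .
    qed
    then show "D (c t) \<le> H * max (dist (c 0) (c T)) (max (D (c 0)) (D (c T)))"
      using t0(2)[OF t] by (simp add: S_def)
  qed
qed

section \<open>Thin triangles\<close>

lemma hyperbolic: "gromov_hyperbolic \<Omega> d"
proof -
  obtain K where K1: "1 \<le> K" and cone:
    "\<And>c T t. \<lbrakk>geod c T; t \<in> {0..T}\<rbrakk>
       \<Longrightarrow> dist (c 0) (c t) \<le> K * D (c t) \<or> dist (c T) (c t) \<le> K * D (c t)"
    and height: "\<And>c T t. \<lbrakk>geod c T; t \<in> {0..T}\<rbrakk>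
       \<Longrightarrow> D (c t) \<le> K * max (dist (c 0) (c T)) (max (D (c 0)) (D (c T)))"
    using geodesic_cone_and_height by blast
  have "0 < K" using K1 by simp
  \<comment> \<open>Take the point of the side at distance exactly \<rho> from \<open>x\<close>. If
    it is lower than \<rho>/K, it must obey the cone bound from \<open>z\<close>, so
    \<open>z\<close> is within \<rho> of it.\<close>
  have side: "(\<exists>q\<in>S. dist x q \<le> \<rho> \<and> \<rho> \<le> K * D q) \<or> dist x z \<le> 2 * \<rho>"
    if S: "geodesic_segment \<Omega> d x z S" and "0 < \<rho>" for x z S \<rho>
  proof -
    obtain c T where c: "geod c T" "c 0 = x" "c T = z" "S = c ` {0..T}"
      using S unfolding geodesic_segment_iff by (elim exE conjE)
    have T: "0 \<le> T" using c by (simp add: geod_def)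
    show ?thesis
    proof (cases "dist x z \<le> \<rho>")
      case True
      then show ?thesis using \<open>0 < \<rho>\<close> by simp
    next
      case False
      have "continuous_on {0..T} (\<lambda>t. dist x (c t))"
        using geod_continuous[OF c(1)] by (intro continuous_intros)
      then have "\<exists>t\<ge>0. t \<le> T \<and> dist x (c t) = \<rho>"
        using False T c \<open>0 < \<rho>\<close> by (intro IVT') auto
      then obtain t where t: "t \<in> {0..T}" "dist x (c t) = \<rho>" by auto
      show ?thesis
      proof (cases "\<rho> \<le> K * D (c t)")
        case True
        then show ?thesis using c t by auto
      next
        case False
        then have "dist z (c t) \<le> \<rho>" using cone[OF c(1) t(1)] c t by auto
        then show ?thesis using dist_triangle[of x z "c t"] t by (simp add: dist_commute)
      qed
    qed
  qed
  \<comment> \<open>The point found below is within \<open>(K + 1) * D p\<close> of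
    \<open>p\<close>, and both heights are at least \<open>D p / (8 * K\<^sup>2)\<close>; this is
    \<open>upper_scaled\<close> for their quotient.\<close>
  define r where "r = B + B * ln (1 + (K + 1) * (8 * K\<^sup>2))"
  have half: "\<exists>q\<in>X \<union> Y. d p q \<le> r"
    if seg: "geodesic_segment \<Omega> d x y Z" "geodesic_segment \<Omega> d x z X" "geodesic_segment \<Omega> d z y Y"
      and p: "p \<in> Z" "dist x p \<le> K * D p" for x y z X Y Z p
  proof -
    obtain c T where c: "geod c T" "c 0 = x" "c T = y" "Z = c ` {0..T}"
      using seg(1) unfolding geodesic_segment_iff by (elim exE conjE)
    have sub: "X \<subseteq> \<Omega>" "Y \<subseteq> \<Omega>" "Z \<subseteq> \<Omega>" "x \<in> X" "y \<in> Y" "z \<in> Y"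
      using geodesic_segment_memb[OF seg(1)] geodesic_segment_memb[OF seg(2)]
        geodesic_segment_memb[OF seg(3)] by simp_all
    have pO: "p \<in> \<Omega>" using sub p by blast
    \<comment> \<open>The factor \<open>8 * K\<close> makes the height bound at \<open>p\<close>
      read 8\<rho> <= max (dist x y) (max (D x) (D y)), while short sides only allow dist x y <=
      4\<rho>.\<close>
    define \<rho> where "\<rho> = D p / (8 * K)"
    have "0 < \<rho>" using D_pos[OF pO] K1 by (simp add: \<rho>_def)
    have \<rho>: "8 * K * \<rho> = D p" using K1 by (simp add: \<rho>_def)
    have \<rho>8: "8 * \<rho> \<le> D p" using \<rho> \<open>0 < \<rho>\<close> K1 mult_right_mono[of 8 "8 * K" \<rho>] by simp
    have scale: "D p / (8 * K\<^sup>2) = \<rho> / K" by (simp add: \<rho>_def power2_eq_square)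
    have "\<exists>q\<in>X \<union> Y. dist p q \<le> (K + 1) * D p \<and> D p / (8 * K\<^sup>2) \<le> D q"
    proof (cases "\<exists>q\<in>X. dist x q \<le> \<rho> \<and> \<rho> \<le> K * D q")
      case True
      then obtain q where q: "q \<in> X" "dist x q \<le> \<rho>" "\<rho> \<le> K * D q" by blast
      have "dist p q \<le> K * D p + \<rho>" using dist_triangle[of p q x] p q by (simp add: dist_commute)
      then have "dist p q \<le> (K + 1) * D p" using \<rho>8 \<open>0 < \<rho>\<close> by (simp add: algebra_simps)
      moreover have "\<rho> / K \<le> D q" using q \<open>0 < K\<close> by (simp add: field_simps)
      ultimately show ?thesis using q(1) scale by auto
    next
      case F1: False
      then have xz: "dist x z \<le> 2 * \<rho>" using side[OF seg(2) \<open>0 < \<rho>\<close>] by blast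
      show ?thesis
      proof (cases "\<exists>q\<in>Y. dist z q \<le> \<rho> \<and> \<rho> \<le> K * D q")
        case True
        then obtain q where q: "q \<in> Y" "dist z q \<le> \<rho>" "\<rho> \<le> K * D q" by blast
        have "dist p q \<le> K * D p + 3 * \<rho>"
          using dist_triangle[of p q x] dist_triangle[of x q z] xz p q by (simp add: dist_commute)
        then have "dist p q \<le> (K + 1) * D p" using \<rho>8 \<open>0 < \<rho>\<close> by (simp add: algebra_simps)
        moreover have "\<rho> / K \<le> D q" using q \<open>0 < K\<close> by (simp add: field_simps)
        ultimately show ?thesis using q(1) scale by auto
      next
        case False
        \<comment> \<open>Both other sides are short, so the height bound forces \<open>x\<close> or
          \<open>y\<close> itself up to height 8\<rho>; that vertex is the required point.\<close>
        then have "dist z y \<le> 2 * \<rho>" using side[OF seg(3) \<open>0 < \<rho>\<close>] by blast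
        then have xy: "dist x y \<le> 4 * \<rho>" using dist_triangle[of x y z] xz by simp
        obtain t where t: "t \<in> {0..T}" "p = c t" using p c by blast
        have "8 * K * \<rho> \<le> K * max (dist x y) (max (D x) (D y))"
          using height[OF c(1) t(1)] c t \<rho> by simp
        then have "8 * \<rho> \<le> max (dist x y) (max (D x) (D y))" using \<open>0 < K\<close> by simp
        then have "8 * \<rho> \<le> D x \<or> 8 * \<rho> \<le> D y" using xy \<open>0 < \<rho>\<close> by linarith
        moreover have "\<rho> / K \<le> \<rho>" using K1 \<open>0 < \<rho>\<close> by (simp add: field_simps)
        ultimately have D: "\<rho> / K \<le> D x \<or> \<rho> / K \<le> D y" using \<open>0 < \<rho>\<close> by linarith
        have "dist p x \<le> (K + 1) * D p" using p D_pos[OF pO] by (simp add: algebra_simps dist_commute)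
        moreover have "dist p y \<le> K * D p + 4 * \<rho>"
          using dist_triangle[of p y x] p xy by (simp add: dist_commute)
        then have "dist p y \<le> (K + 1) * D p" using \<rho>8 \<open>0 < \<rho>\<close> by (simp add: algebra_simps)
        ultimately show ?thesis using D sub(4,5) scale by auto
      qed
    qed
    then obtain q where q: "q \<in> X \<union> Y" "dist p q \<le> (K + 1) * D p" "D p / (8 * K\<^sup>2) \<le> D q" by blast
    have "1 \<le> K\<^sup>2" using K1 by simp
    then have "D p / (8 * K\<^sup>2) \<le> D p / 1" using D_pos[OF pO] by (intro divide_left_mono) auto
    then have "D p / (8 * K\<^sup>2) \<le> D p" by simp
    moreover have "(K + 1) * D p = (K + 1) * (8 * K\<^sup>2) * (D p / (8 * K\<^sup>2))" using K1 by simp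
    ultimately have "d p q \<le> r" unfolding r_def
      using q sub pO D_pos[OF pO] K1 by (intro upper_scaled[of _ _ "D p / (8 * K\<^sup>2)"]) auto
    then show ?thesis using q(1) by blast
  qed
  \<comment> \<open>The extra 1 accounts for the strict inequality in \<open>metric_nbhd\<close>. A
    point satisfying the cone bound only from \<open>y\<close> is treated by reversing all
    sides.\<close>
  have thin: "Z \<subseteq> metric_nbhd \<Omega> d (r + 1) (X \<union> Y)"
    if seg: "geodesic_segment \<Omega> d x y Z" "geodesic_segment \<Omega> d x z X" "geodesic_segment \<Omega> d z y Y"
    for x y z X Y Z
  proof
    fix p assume p: "p \<in> Z"
    obtain c T where c: "geod c T" "c 0 = x" "c T = y" "Z = c ` {0..T}"
      using seg(1) unfolding geodesic_segment_iff by (elim exE conjE)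
    obtain t where t: "t \<in> {0..T}" "p = c t" using p c by blast
    have "\<exists>q\<in>X \<union> Y. d p q \<le> r"
    proof (cases "dist x p \<le> K * D p")
      case True
      then show ?thesis using half[OF seg p] by blast
    next
      case False
      then have "dist y p \<le> K * D p" using cone[OF c(1) t(1)] c t by blast
      then show ?thesis
        using half[OF seg(1,3,2)[THEN geodesic_segment_commute] p] by blast
    qed
    then obtain q where "q \<in> X \<union> Y" "d p q < r + 1" by fastforce
    moreover have "p \<in> \<Omega>" using t geod_in[OF c(1)] by blast
    ultimately show "p \<in> metric_nbhd \<Omega> d (r + 1) (X \<union> Y)" unfolding metric_nbhd_def by blast
  qed
  have "0 \<le> (K + 1) * (8 * K\<^sup>2)" using K1 by simp
  then have "0 \<le> ln (1 + (K + 1) * (8 * K\<^sup>2))" by (intro ln_ge_zero) linarith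
  then have "0 < r + 1" using B_pos by (simp add: r_def add_pos_nonneg)
  moreover have side_thin: "P \<subseteq> metric_nbhd \<Omega> d (r + 1) (Q \<union> R)"
    if "geodesic_segment \<Omega> d y z P" "geodesic_segment \<Omega> d z x Q" "geodesic_segment \<Omega> d x y R"
    for x y z P Q R
    using thin[OF that(1) that(3,2)[THEN geodesic_segment_commute]] by (simp add: Un_commute)
  ultimately have "\<exists>r>0. \<forall>x\<in>\<Omega>. \<forall>y\<in>\<Omega>. \<forall>z\<in>\<Omega>. \<forall>P Q R.
        geodesic_segment \<Omega> d y z P \<and> geodesic_segment \<Omega> d z x Q \<and> geodesic_segment \<Omega> d x y R \<longrightarrow>
        P \<subseteq> metric_nbhd \<Omega> d r (Q \<union> R) \<and>
        Q \<subseteq> metric_nbhd \<Omega> d r (R \<union> P) \<and>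
        R \<subseteq> metric_nbhd \<Omega> d r (P \<union> Q)"
    by (intro exI[of _ "r + 1"] conjI ballI allI impI; (elim conjE)?) (assumption | rule side_thin)+
  then show ?thesis unfolding gromov_hyperbolic_def using metric proper geodesic by blast
qed

end

section \<open>Chains of lightlike geodesics\<close>

lemma cross_ratio_eq:
  "((s - 1) * (t + 1)) / ((s + 1) * (t - 1)) = ((1 - s) * (1 + t)) / ((1 + s) * (1 - t))" for s t :: real
proof -
  have "(s - 1) * (t + 1) = - ((1 - s) * (1 + t))" "(s + 1) * (t - 1) = - ((1 + s) * (1 - t))"
    by (simp_all add: algebra_simps)
  then show ?thesis by (metis minus_divide_divide)
qed

text \<open>\<open>artanh\<close> is half the arc length coordinate of I, in which subdivision and
  reflection of links are evident.\<close>

lemma rho_I_artanh: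
  assumes "s \<in> {-1<..<1}" "t \<in> {-1<..<1}"
  shows "rho_I s t = 2 * \<bar>artanh t - artanh s\<bar>"
proof -
  have "((s - 1) * (t + 1)) / ((s + 1) * (t - 1)) = ((1 + t) / (1 - t)) / ((1 + s) / (1 - s))"
    unfolding cross_ratio_eq by (simp add: mult_ac)
  moreover have "0 < (1 + t) / (1 - t)" "0 < (1 + s) / (1 - s)" using assms by auto
  ultimately have "rho_I s t = \<bar>ln ((1 + t) / (1 - t)) - ln ((1 + s) / (1 - s))\<bar>"
    unfolding rho_I_def using ln_div[of "(1 + t) / (1 - t)" "(1 + s) / (1 - s)"] assms by auto
  moreover have "\<bar>a - b\<bar> = 2 * \<bar>a / 2 - b / 2\<bar>" for a b :: real
    by (simp add: abs_if field_simps)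
  ultimately show ?thesis unfolding artanh_def by metis
qed

text \<open>In the half-line coordinate (1-u)/(1+u), which vanishes at the end u = 1, the left side
  is the displacement from s to t divided by the distance of s to that end. Moving away from the end
  gives equality, moving towards it a smaller value.\<close>

lemma exp_rho_I_ge:
  assumes st: "s \<in> {-1<..<1}" "t \<in> {-1<..<1}"
  shows "2 * \<bar>t - s\<bar> / ((1 - s) * (1 + t)) \<le> exp (rho_I s t) - 1"
proof -
  define X where "X = ((1 - s) * (1 + t)) / ((1 + s) * (1 - t))"
  have pos: "0 < (1 - s) * (1 + t)" "0 < (1 + s) * (1 - t)" using st by auto
  then have "0 < X" by (simp add: X_def)
  have rho: "rho_I s t = \<bar>ln X\<bar>" unfolding rho_I_def cross_ratio_eq X_def ..
  have "exp (ln X) \<le> exp (rho_I s t)" "exp (- ln X) \<le> exp (rho_I s t)" unfolding rho by simp_all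
  then have X: "X \<le> exp (rho_I s t)" "1 / X \<le> exp (rho_I s t)"
    using \<open>0 < X\<close> by (simp_all add: exp_minus inverse_eq_divide)
  show ?thesis
  proof (cases "s \<le> t")
    case True
    have "2 * \<bar>t - s\<bar> / ((1 - s) * (1 + t)) \<le> 2 * (t - s) / ((1 + s) * (1 - t))"
      using pos True by (intro frac_le) (auto simp: algebra_simps)
    also have "\<dots> = X - 1" using pos unfolding X_def by (simp add: field_simps)
    finally show ?thesis using X by linarith
  next
    case False
    have "2 * \<bar>t - s\<bar> / ((1 - s) * (1 + t)) = 1 / X - 1"
      using pos False unfolding X_def by (simp add: field_simps)
    then show ?thesis using X by linarith
  qed
qed

definition lightlike_link :: "'n::finite mink set \<Rightarrow> 'n mink \<Rightarrow> 'n mink \<Rightarrow> real \<Rightarrow> bool" where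
  "lightlike_link \<Omega> x y l \<longleftrightarrow> (\<exists>\<gamma> s t. proj_lightlike_geodesic \<Omega> \<gamma> \<and> s \<in> {-1<..<1} \<and> t \<in> {-1<..<1} \<and>
     \<gamma> s = x \<and> \<gamma> t = y \<and> l = rho_I s t)"

text \<open>Carrying the length in an inductive relation replaces families indexed by k:
  concatenation, reversal and cutting become rule inductions.\<close>

inductive reach :: "'n::finite mink set \<Rightarrow> 'n mink \<Rightarrow> 'n mink \<Rightarrow> real \<Rightarrow> bool" for \<Omega> where
  link: "lightlike_link \<Omega> x y l \<Longrightarrow> reach \<Omega> x y l"
| step: "reach \<Omega> x y l \<Longrightarrow> lightlike_link \<Omega> y z l' \<Longrightarrow> reach \<Omega> x z (l + l')"

lemma reach_iff_chain:
  "reach \<Omega> x y l \<longleftrightarrow> (\<exists>m \<gamma> s t. lightlike_chain \<Omega> x y m \<gamma> s t \<and> l = (\<Sum>k = 1..m. rho_I (s k) (t k)))"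
proof
  assume "reach \<Omega> x y l"
  then show "\<exists>m \<gamma> s t. lightlike_chain \<Omega> x y m \<gamma> s t \<and> l = (\<Sum>k = 1..m. rho_I (s k) (t k))"
  proof induction
    case (link x y l)
    then obtain \<gamma> s t where "proj_lightlike_geodesic \<Omega> \<gamma>" "s \<in> {-1<..<1}" "t \<in> {-1<..<1}"
      "\<gamma> s = x" "\<gamma> t = y" "l = rho_I s t" unfolding lightlike_link_def by blast
    then show ?case unfolding lightlike_chain_def
      by (intro exI[of _ 1] exI[of _ "\<lambda>_. \<gamma>"] exI[of _ "\<lambda>_. s"] exI[of _ "\<lambda>_. t"]) auto
  next
    case (step x y l z l')
    then obtain m \<gamma> s t where c: "lightlike_chain \<Omega> x y m \<gamma> s t" "l = (\<Sum>k = 1..m. rho_I (s k) (t k))"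
      by blast
    obtain g a b where g: "proj_lightlike_geodesic \<Omega> g" "a \<in> {-1<..<1}" "b \<in> {-1<..<1}"
      "g a = y" "g b = z" "l' = rho_I a b" using step.hyps(2) unfolding lightlike_link_def by blast
    let ?\<gamma> = "\<gamma>(Suc m := g)" and ?s = "s(Suc m := a)" and ?t = "t(Suc m := b)"
    have m: "1 \<le> m" using c(1) by (simp add: lightlike_chain_def)
    have "lightlike_chain \<Omega> x z (Suc m) ?\<gamma> ?s ?t"
      unfolding lightlike_chain_def
    proof (intro conjI ballI)
      fix k assume k: "k \<in> {1..<Suc m}"
      show "?\<gamma> k (?t k) = ?\<gamma> (k + 1) (?s (k + 1))"
        using c(1) g k m unfolding lightlike_chain_def by (cases "k = m") auto
    qed (use c(1) g m in \<open>auto simp: lightlike_chain_def\<close>)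
    moreover have "(\<Sum>k = 1..Suc m. rho_I (?s k) (?t k)) = l + l'"
      using m c(2) g(6) by simp
    ultimately show ?case by metis
  qed
next
  assume "\<exists>m \<gamma> s t. lightlike_chain \<Omega> x y m \<gamma> s t \<and> l = (\<Sum>k = 1..m. rho_I (s k) (t k))"
  then obtain m \<gamma> s t where c: "lightlike_chain \<Omega> x y m \<gamma> s t" "l = (\<Sum>k = 1..m. rho_I (s k) (t k))"
    by blast
  have link: "lightlike_link \<Omega> (\<gamma> k (s k)) (\<gamma> k (t k)) (rho_I (s k) (t k))" if "k \<in> {1..m}" for k
    using c(1) that unfolding lightlike_chain_def lightlike_link_def by blast
  have "reach \<Omega> x (\<gamma> j (t j)) (\<Sum>k = 1..j. rho_I (s k) (t k))" if "1 \<le> j" "j \<le> m" for j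
    using that
  proof (induction j rule: dec_induct)
    case base
    then show ?case using reach.link[OF link[of 1]] c(1) by (simp add: lightlike_chain_def)
  next
    case (step j)
    then have "\<gamma> j (t j) = \<gamma> (Suc j) (s (Suc j))"
      using c(1) unfolding lightlike_chain_def by (simp add: Suc_le_eq)
    then show ?case using step reach.step[OF _ link[of "Suc j"]] by simp
  qed
  then show "reach \<Omega> x y l" using c unfolding lightlike_chain_def by auto
qed

lemma lightlike_linkI:
  "proj_lightlike_geodesic \<Omega> \<gamma> \<Longrightarrow> s \<in> {-1<..<1} \<Longrightarrow> t \<in> {-1<..<1}
     \<Longrightarrow> lightlike_link \<Omega> (\<gamma> s) (\<gamma> t) (rho_I s t)"
  unfolding lightlike_link_def by blast

lemma lightlike_link_in: "lightlike_link \<Omega> x y l \<Longrightarrow> x \<in> \<Omega> \<and> y \<in> \<Omega>"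
  unfolding lightlike_link_def proj_lightlike_geodesic_def by blast

lemma lightlike_link_commute: "lightlike_link \<Omega> x y l \<Longrightarrow> lightlike_link \<Omega> y x l"
  unfolding lightlike_link_def by (metis rho_I_artanh abs_minus_commute)

lemma lightlike_link_nonneg: "lightlike_link \<Omega> x y l \<Longrightarrow> 0 \<le> l"
  unfolding lightlike_link_def rho_I_def by auto

lemma lightlike_link_split:
  assumes "lightlike_link \<Omega> x y l" "0 \<le> a" "a \<le> l"
  shows "\<exists>z. lightlike_link \<Omega> x z a \<and> lightlike_link \<Omega> z y (l - a)"
proof -
  obtain \<gamma> s t where g: "proj_lightlike_geodesic \<Omega> \<gamma>" "s \<in> {-1<..<1}" "t \<in> {-1<..<1}"
      "\<gamma> s = x" "\<gamma> t = y" "l = rho_I s t" using assms(1) unfolding lightlike_link_def by blast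
  \<comment> \<open>Since \<open>rho_I\<close> is twice the distance in the \<open>artanh\<close>
    coordinate, a cut at length \<open>a\<close> is a shift by \<open>a / 2\<close> from
    \<open>s\<close> towards \<open>t\<close>.\<close>
  define c where "c = (if artanh s \<le> artanh t then artanh s + a / 2 else artanh s - a / 2)"
  define u where "u = tanh c"
  have u: "u \<in> {-1<..<1}" by (simp add: u_def tanh_real_lt_1 tanh_real_gt_neg1)
  have "artanh u = c" by (simp add: u_def artanh_tanh_real)
  then have "rho_I s u = a" "rho_I u t = l - a"
    using assms(2,3) g(2,3,6) u by (auto simp: rho_I_artanh c_def abs_if split: if_splits)
  then have "lightlike_link \<Omega> x (\<gamma> u) a" "lightlike_link \<Omega> (\<gamma> u) y (l - a)"
    using lightlike_linkI[OF g(1,2) u] lightlike_linkI[OF g(1) u g(3)] g(4,5) by simp_all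
  then show ?thesis by blast
qed

lemma reach_in: "reach \<Omega> x y l \<Longrightarrow> x \<in> \<Omega> \<and> y \<in> \<Omega>"
  by (induction rule: reach.induct) (auto dest: lightlike_link_in)

lemma reach_nonneg: "reach \<Omega> x y l \<Longrightarrow> 0 \<le> l"
  by (induction rule: reach.induct) (auto dest: lightlike_link_nonneg)

lemma reach_trans: "reach \<Omega> y z l' \<Longrightarrow> reach \<Omega> x y l \<Longrightarrow> reach \<Omega> x z (l + l')"
proof (induction arbitrary: l rule: reach.induct)
  case (step a b k c k')
  then show ?case using reach.step[of \<Omega> x b "l + k" c k'] by (simp add: add.assoc)
qed (rule reach.step)

lemma reach_commute: "reach \<Omega> x y l \<Longrightarrow> reach \<Omega> y x l"
proof (induction rule: reach.induct)
  case (step x y l z l')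
  then show ?case
    using reach_trans[OF step.IH reach.link[OF lightlike_link_commute[OF step.hyps(2)]]]
    by (simp add: add.commute)
qed (simp add: reach.link lightlike_link_commute)

text \<open>Cuts at an exact length are the source of \<open>almost_between\<close>: one that falls
  inside the last link is made within that link, any other is left to the induction.\<close>

lemma reach_split:
  assumes "reach \<Omega> x y l" "0 \<le> a" "a \<le> l"
  shows "\<exists>z. reach \<Omega> x z a \<and> reach \<Omega> z y (l - a)"
  using assms
proof (induction arbitrary: a rule: reach.induct)
  case (link x y l)
  then show ?case using lightlike_link_split reach.link by blast
next
  case (step x y l z l')
  show ?case
  proof (cases "a \<le> l")
    case True
    then obtain w where "reach \<Omega> x w a" "reach \<Omega> w y (l - a)" using step by blast
    moreover have "reach \<Omega> w z (l - a + l')" using calculation(2) step.hyps(2) by (rule reach.step)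
    moreover have "l - a + l' = l + l' - a" by simp
    ultimately show ?thesis by metis
  next
    case False
    then obtain w where w: "lightlike_link \<Omega> y w (a - l)" "lightlike_link \<Omega> w z (l' - (a - l))"
      using lightlike_link_split[OF step.hyps(2), of "a - l"] step.prems by auto
    have "reach \<Omega> x w (l + (a - l))" using step.hyps(1) w(1) by (rule reach.step)
    moreover have "reach \<Omega> w z (l + l' - a)" using reach.link[OF w(2)] by (simp add: algebra_simps)
    moreover have "l + (a - l) = a" by simp
    ultimately show ?thesis by metis
  qed
qed

section \<open>The distance as an infimum over chains\<close>

lemma markowitz_dist_reach:
  "x \<in> \<Omega> \<Longrightarrow> y \<in> \<Omega> \<Longrightarrow> markowitz_dist \<Omega> x y = Inf {l. reach \<Omega> x y l}"
  unfolding markowitz_dist_def reach_iff_chain by (auto intro!: arg_cong[where f = Inf])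

lemma markowitz_dist_le:
  assumes "reach \<Omega> x y l" shows "markowitz_dist \<Omega> x y \<le> l"
proof -
  have "bdd_below {l. reach \<Omega> x y l}" by (rule bdd_belowI[of _ 0]) (auto dest: reach_nonneg)
  then show ?thesis
    using assms reach_in[OF assms] by (simp add: markowitz_dist_reach cInf_lower)
qed

text \<open>The hypothesis excludes the infimum of an empty set.\<close>

lemma markowitz_dist_nonneg:
  assumes "x \<in> \<Omega> \<Longrightarrow> y \<in> \<Omega> \<Longrightarrow> \<exists>l. reach \<Omega> x y l" shows "0 \<le> markowitz_dist \<Omega> x y"
proof (cases "x \<in> \<Omega> \<and> y \<in> \<Omega>")
  case True
  then have "{l. reach \<Omega> x y l} \<noteq> {}" using assms by blast
  then have "0 \<le> Inf {l. reach \<Omega> x y l}"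
    by (rule cInf_greatest) (simp add: reach_nonneg)
  then show ?thesis using True by (simp add: markowitz_dist_reach)
qed (auto simp: markowitz_dist_def)

lemma markowitz_dist_commute: "markowitz_dist \<Omega> x y = markowitz_dist \<Omega> y x"
proof -
  have "reach \<Omega> x y = reach \<Omega> y x" using reach_commute by blast
  then show ?thesis
    by (cases "x \<in> \<Omega> \<and> y \<in> \<Omega>") (auto simp: markowitz_dist_reach, auto simp: markowitz_dist_def)
qed

lemma markowitz_dist_approx:
  assumes "reach \<Omega> x y k" "0 < e" shows "\<exists>l. reach \<Omega> x y l \<and> l < markowitz_dist \<Omega> x y + e"
proof -
  have "\<exists>l\<in>{l. reach \<Omega> x y l}. l < Inf {l. reach \<Omega> x y l} + e"
    using assms by (intro cInf_lessD) auto
  then show ?thesis using reach_in[OF assms(1)] by (simp add: markowitz_dist_reach)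
qed

section \<open>Lower bound for the Markowitz distance\<close>

lemma mink_null_iff: "mink_form v v = 0 \<longleftrightarrow> norm (snd v) = \<bar>fst v\<bar>"
proof -
  have "mink_form v v = (norm (snd v))\<^sup>2 - \<bar>fst v\<bar>\<^sup>2"
    by (simp add: mink_form_def dot_square_norm power2_eq_square)
  then show ?thesis using power2_eq_iff_nonneg[of "norm (snd v)" "\<bar>fst v\<bar>"] by auto
qed

lemma lightlike_norm:
  assumes "lightlike mink_form v"
  shows "fst v \<noteq> 0" "norm v \<le> 2 * \<bar>fst v\<bar>"
proof -
  have n: "norm (snd v) = \<bar>fst v\<bar>" using assms mink_null_iff[of v] by (simp add: lightlike_def)
  then show "fst v \<noteq> 0" using assms by (auto simp: lightlike_def prod_eq_iff)
  show "norm v \<le> 2 * \<bar>fst v\<bar>" using n norm_Pair_le[of "fst v" "snd v"] by simp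
qed

text \<open>A pole -d/c outside I means |c| <= |d|. Multiplying \<open>c\<close> and
  \<open>d\<close> by the sign of \<open>d\<close> leaves the product of the two denominators
  unchanged and makes both positive.\<close>

lemma homography_on_I_difference:
  assumes "homography_on_I h"
  obtains \<delta> c d where "\<delta> \<noteq> 0" "0 < d" "\<bar>c\<bar> \<le> d"
    "\<And>s t. \<lbrakk>s \<in> {-1<..<1}; t \<in> {-1<..<1}\<rbrakk> \<Longrightarrow> h t - h s = \<delta> * (t - s) / ((c * s + d) * (c * t + d))"
proof -
  obtain a b c d where det: "a * d - b * c \<noteq> 0"
    and h: "\<And>s. s \<in> {-1<..<1} \<Longrightarrow> c * s + d \<noteq> 0 \<and> h s = (a * s + b) / (c * s + d)"
    using assms unfolding homography_on_I_def by blast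
  have "d \<noteq> 0" using h[of 0] by simp
  have "\<bar>c\<bar> \<le> \<bar>d\<bar>"
  proof (rule ccontr)
    assume "\<not> ?thesis"
    then have "c \<noteq> 0" "\<bar>d\<bar> < \<bar>c\<bar>" by auto
    define q where "q = - d / c"
    have "\<bar>q\<bar> < 1" using \<open>c \<noteq> 0\<close> \<open>\<bar>d\<bar> < \<bar>c\<bar>\<close> by (simp add: q_def abs_divide)
    then have "q \<in> {-1<..<1}" by auto
    then show False using h[of q] \<open>c \<noteq> 0\<close> by (simp add: q_def)
  qed
  have "h t - h s = (a * d - b * c) * (t - s) / ((sgn d * c * s + \<bar>d\<bar>) * (sgn d * c * t + \<bar>d\<bar>))"
    if "s \<in> {-1<..<1}" "t \<in> {-1<..<1}" for s t
  proof -
    have "h t - h s = (a * d - b * c) * (t - s) / ((c * s + d) * (c * t + d))"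
      using h[OF that(1)] h[OF that(2)] by (simp add: field_simps)
    moreover have "(sgn d * c * s + \<bar>d\<bar>) * (sgn d * c * t + \<bar>d\<bar>) = (c * s + d) * (c * t + d)"
      using \<open>d \<noteq> 0\<close> by (cases "0 < d") (auto simp: algebra_simps)
    ultimately show ?thesis by simp
  qed
  then show ?thesis
    using det \<open>d \<noteq> 0\<close> \<open>\<bar>c\<bar> \<le> \<bar>d\<bar>\<close> by (intro that[of "a * d - b * c" "\<bar>d\<bar>" "sgn d * c"]) (auto simp: abs_mult)
qed

lemma affine_pos_on_I:
  fixes c d u :: real
  assumes d: "0 < d" "\<bar>c\<bar> \<le> d" and u: "u \<in> {-1<..<1}"
  shows "0 < c * u + d"
proof -
  have "\<bar>c * u\<bar> \<le> \<bar>c\<bar> * \<bar>u\<bar>" by (simp add: abs_mult)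
  also have "\<dots> \<le> d * \<bar>u\<bar>" using d by (intro mult_right_mono) auto
  also have "\<dots> < d" using u d by auto
  finally show ?thesis by linarith
qed

text \<open>The hypothesis says that one end of the geodesic, the limit \<open>u \<rightarrow> 1\<close>, is within reach \<open>R\<close>;
  the conclusion is the comparison with the half-line ending there.\<close>

lemma homography_one_sided_bound:
  assumes d: "0 < d" "\<bar>c\<bar> \<le> d" and k: "0 < k" and s: "s \<in> {-1<..<1}" and t: "t \<in> {-1<..<1}"
    and bound: "\<And>u. u \<in> {s..<1} \<Longrightarrow> k * (u - s) \<le> R * ((c * s + d) * (c * u + d))"
  shows "k * \<bar>t - s\<bar> / ((c * s + d) * (c * t + d)) \<le> R * (exp (rho_I s t) - 1)"
proof -
  note pos = affine_pos_on_I[OF d]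
  \<comment> \<open>At the limit the left side is still positive, which forces \<open>c + d\<close>
    to be positive: the homography has no pole at 1.\<close>
  have lim: "k * (1 - s) \<le> R * ((c * s + d) * (c * 1 + d))"
  proof (rule tendsto_le)
    show "((\<lambda>u. k * (u - s)) \<longlongrightarrow> k * (1 - s)) (at_left 1)" by (intro tendsto_intros)
    show "((\<lambda>u. R * ((c * s + d) * (c * u + d))) \<longlongrightarrow> R * ((c * s + d) * (c * 1 + d))) (at_left 1)"
      by (intro tendsto_intros)
    show "\<forall>\<^sub>F u in at_left 1. k * (u - s) \<le> R * ((c * s + d) * (c * u + d))"
      using eventually_at_left_real[of s 1] s by (auto elim!: eventually_mono intro!: bound)
  qed simp
  have "0 < k * (1 - s)" using k s by simp
  with lim have "0 < R * ((c * s + d) * (c + d))" by simp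
  moreover have "0 \<le> (c * s + d) * (c + d)" using d pos[OF s] by (intro mult_nonneg_nonneg) auto
  ultimately have "0 < R" "0 < (c * s + d) * (c + d)"
    by (auto simp: zero_less_mult_iff[of R])
  then have cd: "0 < c + d" "0 < R" using pos[OF s] by (auto simp: zero_less_mult_iff)
  have "k / (c * s + d) \<le> R * (c + d) / (1 - s)"
    using lim pos[OF s] s by (simp add: field_simps)
  then have "k / (c * s + d) * (\<bar>t - s\<bar> / (c * t + d)) \<le> R * (c + d) / (1 - s) * (\<bar>t - s\<bar> / (c * t + d))"
    using pos[OF t] by (intro mult_right_mono) auto
  \<comment> \<open>The right side exceeds the left by (d - c) * (1 - t). Equality at c = d is the
    extremal case: a pole at -1, with a half-line as image.\<close>
  also have "(c + d) * (1 + t) \<le> 2 * (c * t + d)"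
    using d t mult_nonneg_nonneg[of "d - c" "1 - t"] by (simp add: algebra_simps)
  then have "(c + d) / (c * t + d) \<le> 2 / (1 + t)"
    using pos[OF t] t by (simp add: field_simps)
  then have "R * \<bar>t - s\<bar> / (1 - s) * ((c + d) / (c * t + d)) \<le> R * \<bar>t - s\<bar> / (1 - s) * (2 / (1 + t))"
    using cd s by (intro mult_left_mono) auto
  then have "R * (c + d) / (1 - s) * (\<bar>t - s\<bar> / (c * t + d)) \<le> R * (2 * \<bar>t - s\<bar> / ((1 - s) * (1 + t)))"
    by (simp add: mult_ac)
  also have "\<dots> \<le> R * (exp (rho_I s t) - 1)"
    using exp_rho_I_ge[OF s t] cd by (intro mult_left_mono) auto
  finally show ?thesis by simp
qed

text \<open>The sign of \<open>k * \<delta>\<close> tells which end of I lies in the bounded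
  direction. The reflection u -> -u, which preserves \<open>rho_I\<close>, exchanges the
  ends.\<close>

lemma homography_bound:
  assumes h: "homography_on_I h" and k: "k \<noteq> 0" and s: "s \<in> {-1<..<1}" and t: "t \<in> {-1<..<1}"
    and bound: "\<And>u. u \<in> {-1<..<1} \<Longrightarrow> 0 \<le> k * (h u - h s) \<Longrightarrow> k * (h u - h s) \<le> R"
  shows "\<bar>k\<bar> * \<bar>h t - h s\<bar> \<le> R * (exp (rho_I s t) - 1)"
proof -
  obtain \<delta> c d where \<delta>: "\<delta> \<noteq> 0" and d: "0 < d" "\<bar>c\<bar> \<le> d" and diff:
    "\<And>s t. \<lbrakk>s \<in> {-1<..<1}; t \<in> {-1<..<1}\<rbrakk> \<Longrightarrow> h t - h s = \<delta> * (t - s) / ((c * s + d) * (c * t + d))"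
    using homography_on_I_difference[OF h] by metis
  note pos = affine_pos_on_I[OF d]
  have side: "k * \<delta> * (u - s) \<le> R * ((c * s + d) * (c * u + d))"
    if u: "u \<in> {-1<..<1}" "0 \<le> k * \<delta> * (u - s)" for u
  proof -
    have eq: "k * (h u - h s) = k * \<delta> * (u - s) / ((c * s + d) * (c * u + d))"
      using diff[OF s u(1)] by simp
    moreover have P: "0 < (c * s + d) * (c * u + d)" using pos s u(1) by simp
    ultimately have "k * \<delta> * (u - s) / ((c * s + d) * (c * u + d)) \<le> R"
      using bound[OF u(1)] u(2) by simp
    then show ?thesis using P by (simp add: pos_divide_le_eq)
  qed
  have "\<bar>k\<bar> * \<bar>h t - h s\<bar> = \<bar>k * \<delta>\<bar> * \<bar>t - s\<bar> / ((c * s + d) * (c * t + d))"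
    using diff[OF s t] pos[OF s] pos[OF t] by (simp add: abs_mult)
  also have "\<dots> \<le> R * (exp (rho_I s t) - 1)"
  proof (cases "0 < k * \<delta>")
    case True
    then show ?thesis using side s homography_one_sided_bound[OF d True s t, of R] by auto
  next
    case False
    then have neg: "0 < - (k * \<delta>)" using k \<delta> by (simp add: mult_less_0_iff not_less order_less_le)
    have d': "0 < d" "\<bar>- c\<bar> \<le> d" using d by auto
    have st': "- s \<in> {-1<..<1}" "- t \<in> {-1<..<1}" using s t by auto
    have "- (k * \<delta>) * \<bar>- t - - s\<bar> / ((- c * - s + d) * (- c * - t + d)) \<le> R * (exp (rho_I (- s) (- t)) - 1)"
    proof (rule homography_one_sided_bound[OF d' neg st'])
      fix u assume u: "u \<in> {- s..<1}"
      then have "- u \<in> {-1<..<1}" using s by auto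
      moreover have "0 \<le> k * \<delta> * (- u - s)" using u neg by (intro mult_nonpos_nonpos) auto
      ultimately show "- (k * \<delta>) * (u - - s) \<le> R * ((- c * - s + d) * (- c * u + d))"
        using side[of "- u"] by (simp add: algebra_simps)
    qed
    moreover have "rho_I (- s) (- t) = rho_I s t"
      using rho_I_artanh[OF s t] rho_I_artanh[OF st'] s t artanh_minus_real[of s] artanh_minus_real[of t]
      by auto
    ultimately show ?thesis using neg by (simp add: abs_minus_commute)
  qed
  finally show ?thesis .
qed

text \<open>The time direction \<sigma> is chosen before \<open>w\<close>, so it depends on
  \<open>p\<close> alone. With \<open>fst w = 1\<close>, \<tau> is elapsed time, and the bound
  covers every later return of the ray to \<Omega>, not just its first exit.\<close>

definition null_escape :: "'n::finite mink set \<Rightarrow> real \<Rightarrow> bool" where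
  "null_escape \<Omega> K \<longleftrightarrow> (\<forall>p\<in>\<Omega>. \<exists>\<sigma>\<in>{1,-1}. \<forall>w \<tau>. lightlike mink_form w \<and> fst w = 1 \<and> 0 \<le> \<tau> \<and>
     p + (\<sigma> * \<tau>) *\<^sub>R w \<in> \<Omega> \<longrightarrow> \<tau> \<le> K * infdist p (-\<Omega>))"

lemma lightlike_link_lower:
  assumes esc: "null_escape \<Omega> K" and link: "lightlike_link \<Omega> x y l"
  shows "dist x y \<le> 2 * K * infdist x (-\<Omega>) * (exp l - 1)"
proof -
  obtain \<gamma> s t where st: "s \<in> {-1<..<1}" "t \<in> {-1<..<1}" and xy: "\<gamma> s = x" "\<gamma> t = y" "l = rho_I s t"
    and g: "proj_lightlike_geodesic \<Omega> \<gamma>" using link unfolding lightlike_link_def by blast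
  obtain x0 v h where v: "lightlike mink_form v" and h: "homography_on_I h"
    and \<gamma>: "\<And>u. u \<in> {-1<..<1} \<Longrightarrow> \<gamma> u = x0 + h u *\<^sub>R v \<and> \<gamma> u \<in> \<Omega>"
    using g unfolding proj_lightlike_geodesic_def by blast
  note v' = lightlike_norm[OF v]
  define w where "w = (1 / fst v) *\<^sub>R v"
  have w: "fst w = 1" using v' by (simp add: w_def)
  have lw: "lightlike mink_form w"
    using v v' w unfolding lightlike_def by (auto simp: w_def mink_form_def field_simps)
  obtain \<sigma> where \<sigma>: "\<sigma> = 1 \<or> \<sigma> = -1"
    and esc': "\<And>\<tau>. 0 \<le> \<tau> \<Longrightarrow> x + (\<sigma> * \<tau>) *\<^sub>R w \<in> \<Omega> \<Longrightarrow> \<tau> \<le> K * infdist x (-\<Omega>)"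
    using esc \<gamma>[OF st(1)] xy(1) lw w unfolding null_escape_def by (metis insert_iff singletonD)
  \<comment> \<open>The product \<open>\<sigma> * fst v\<close> converts the parameter of the
    geodesic into time elapsed in the direction \<sigma>, whichever way \<open>v\<close>
    points.\<close>
  have "\<bar>\<sigma> * fst v\<bar> * \<bar>h t - h s\<bar> \<le> K * infdist x (-\<Omega>) * (exp (rho_I s t) - 1)"
  proof (rule homography_bound[OF h _ st])
    show "\<sigma> * fst v \<noteq> 0" using \<sigma> v' by auto
    fix u assume u: "u \<in> {-1<..<1}" "0 \<le> \<sigma> * fst v * (h u - h s)"
    have "x + (\<sigma> * (\<sigma> * fst v * (h u - h s))) *\<^sub>R w = \<gamma> u"
      using \<gamma>[OF u(1)] \<gamma>[OF st(1)] xy(1) \<sigma> v'(1) by (auto simp: w_def algebra_simps)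
    then have "x + (\<sigma> * (\<sigma> * fst v * (h u - h s))) *\<^sub>R w \<in> \<Omega>" using \<gamma>[OF u(1)] by metis
    then show "\<sigma> * fst v * (h u - h s) \<le> K * infdist x (-\<Omega>)" by (rule esc'[OF u(2)])
  qed
  then have *: "\<bar>fst v\<bar> * \<bar>h t - h s\<bar> \<le> K * infdist x (-\<Omega>) * (exp l - 1)" using \<sigma> xy(3) by auto
  have "x - y = (h s - h t) *\<^sub>R v"
    using \<gamma>[OF st(1)] \<gamma>[OF st(2)] xy by (auto simp: algebra_simps)
  then have "dist x y = \<bar>h t - h s\<bar> * norm v" by (simp add: dist_norm abs_minus_commute)
  also have "\<dots> \<le> \<bar>h t - h s\<bar> * (2 * \<bar>fst v\<bar>)" using v' by (intro mult_left_mono) auto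
  finally show ?thesis using * by (simp add: mult_ac)
qed

text \<open>Bernoulli's inequality moves the factor \<open>2 * K\<close> into the exponent. The
  bound in the form D * (exp (n * l) - 1) then composes exactly along a chain, while a factor in
  front would be multiplied at every link.\<close>

lemma reach_lower:
  assumes esc: "null_escape \<Omega> K" and n: "2 * K \<le> real n" "1 \<le> n" and "reach \<Omega> x y l"
  shows "dist x y \<le> infdist x (-\<Omega>) * (exp (real n * l) - 1)"
proof -
  have link: "dist x y \<le> infdist x (-\<Omega>) * (exp (real n * l) - 1)" if "lightlike_link \<Omega> x y l" for x y l
  proof -
    have "1 \<le> exp l" using lightlike_link_nonneg[OF that] by simp
    then have "1 + real n * (exp l - 1) \<le> exp l ^ n"
      using Bernoulli_inequality[of "exp l - 1" n] by simp
    then have "real n * (exp l - 1) \<le> exp (real n * l) - 1" by (simp add: exp_of_nat_mult)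
    moreover have "2 * K * (exp l - 1) \<le> real n * (exp l - 1)"
      using n \<open>1 \<le> exp l\<close> by (intro mult_right_mono) auto
    ultimately have "infdist x (-\<Omega>) * (2 * K * (exp l - 1)) \<le> infdist x (-\<Omega>) * (exp (real n * l) - 1)"
      by (intro mult_left_mono) (auto simp: infdist_nonneg)
    moreover have "dist x y \<le> infdist x (-\<Omega>) * (2 * K * (exp l - 1))"
      using lightlike_link_lower[OF esc that] by (simp only: mult_ac)
    ultimately show ?thesis by linarith
  qed
  show ?thesis using assms(4)
  proof induction
    case (step x y l z l')
    let ?D = "\<lambda>x. infdist x (-\<Omega>)" and ?e = "\<lambda>l. exp (real n * l)"
    have "?D y \<le> ?D x + dist x y" using infdist_triangle[of y "-\<Omega>" x] by (simp add: dist_commute)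
    then have "?D y \<le> ?D x * ?e l" using step.IH by (simp add: algebra_simps)
    moreover have "0 \<le> ?e l' - 1" using lightlike_link_nonneg[OF step.hyps(2)] by simp
    ultimately have "?D y * (?e l' - 1) \<le> ?D x * ?e l * (?e l' - 1)" by (rule mult_right_mono)
    then have "dist x z \<le> ?D x * (?e l - 1) + ?D x * ?e l * (?e l' - 1)"
      using dist_triangle[of x z y] step.IH link[OF step.hyps(2)] by linarith
    also have "\<dots> = ?D x * (?e (l + l') - 1)" by (simp add: algebra_simps exp_add)
    finally show ?case .
  qed (rule link)
qed

section \<open>Upper bound for the Markowitz distance\<close>

text \<open>The affine parametrization of the diameter of a ball around \<open>x\<close> is
  admissible, and \<open>rho_I 0 u\<close> is at most 4|u| for |u| <= 1/2.\<close>

lemma lightlike_link_ball: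
  assumes v: "lightlike mink_form v" and r: "0 < r" and \<tau>: "\<bar>\<tau>\<bar> \<le> r / 2"
    and ball: "r * norm v \<le> infdist x (-\<Omega>)"
  shows "\<exists>l. lightlike_link \<Omega> x (x + \<tau> *\<^sub>R v) l \<and> l \<le> 4 * \<bar>\<tau>\<bar> / r"
proof -
  define u where "u = \<tau> / r"
  have u: "\<bar>u\<bar> \<le> 1 / 2" using r \<tau> by (simp add: u_def field_simps)
  then have u': "u \<in> {-1<..<1}" by auto
  have v0: "0 < norm v" using v by (simp add: lightlike_def)
  have "homography_on_I (\<lambda>s. r * s)" unfolding homography_on_I_def using r
    by (intro exI[of _ r] exI[of _ 0] exI[of _ 0] exI[of _ 1]) auto
  moreover have "x + (r * s) *\<^sub>R v \<in> \<Omega>" if "s \<in> {-1<..<1}" for s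
  proof (rule infdist_compl_ball)
    have "\<bar>r * s\<bar> < r" using that r by (auto simp: abs_mult abs_less_iff)
    then have "dist x (x + (r * s) *\<^sub>R v) < r * norm v"
      using v0 by (simp add: dist_norm)
    then show "dist x (x + (r * s) *\<^sub>R v) < infdist x (-\<Omega>)" using ball by linarith
  qed
  ultimately have "proj_lightlike_geodesic \<Omega> (\<lambda>s. x + (r * s) *\<^sub>R v)"
    unfolding proj_lightlike_geodesic_def using v by blast
  then have "lightlike_link \<Omega> x (x + \<tau> *\<^sub>R v) (rho_I 0 u)"
    unfolding lightlike_link_def using r u'
    by (intro exI[of _ "\<lambda>s. x + (r * s) *\<^sub>R v"] exI[of _ 0] exI[of _ u]) (auto simp: u_def)
  moreover have "rho_I 0 u \<le> 4 * \<bar>u\<bar>"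
  proof -
    have *: "ln ((1 + a) / (1 - a)) \<le> 4 * \<bar>u\<bar>" if "\<bar>a\<bar> = \<bar>u\<bar>" for a
    proof -
      have a: "\<bar>a\<bar> \<le> 1 / 2" using u that by simp
      then have "0 < (1 + a) / (1 - a)" by (intro divide_pos_pos) auto
      then have "ln ((1 + a) / (1 - a)) \<le> (1 + a) / (1 - a) - 1" by (rule ln_le_minus_one)
      also have "\<dots> = 2 * a / (1 - a)" using a by (simp add: field_simps)
      also have "\<dots> \<le> 2 * \<bar>a\<bar> / (1 / 2)" using a by (intro frac_le) auto
      finally show ?thesis using that by simp
    qed
    have "- ln ((1 + u) / (1 - u)) = ln (inverse ((1 + u) / (1 - u)))"
      by (rule ln_inverse[symmetric])
    then have "- ln ((1 + u) / (1 - u)) = ln ((1 + - u) / (1 - - u))" by simp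
    then have "\<bar>ln ((1 + u) / (1 - u))\<bar> \<le> 4 * \<bar>u\<bar>" using *[of u] *[of "- u"] by linarith
    then show ?thesis unfolding rho_I_def cross_ratio_eq by simp
  qed
  ultimately show ?thesis using r by (intro exI[of _ "rho_I 0 u"]) (auto simp: u_def)
qed

text \<open>Each vector lies in a plane spanned by the time axis and one spatial unit vector
  \<open>u\<close>, and the null directions of that plane are \<open>(1, u)\<close> and
  \<open>(-1, u)\<close>.\<close>

lemma null_decomposition:
  fixes z :: "'n::finite mink"
  obtains v w \<alpha> \<beta> where "lightlike mink_form v" "lightlike mink_form w" "norm v \<le> 2" "norm w \<le> 2"
    "z = \<alpha> *\<^sub>R v + \<beta> *\<^sub>R w" "\<bar>\<alpha>\<bar> \<le> norm z" "\<bar>\<beta>\<bar> \<le> norm z"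
proof -
  \<comment> \<open>Without a spatial part any unit vector will do; a coordinate vector is
    taken.\<close>
  define u where "u = (if snd z = 0 then axis undefined 1 else (1 / norm (snd z)) *\<^sub>R snd z)"
  have u: "norm u = 1" by (simp add: u_def norm_axis_1)
  have z: "snd z = norm (snd z) *\<^sub>R u" by (simp add: u_def)
  have null: "lightlike mink_form (a, u)" "norm (a, u) \<le> 2" if "\<bar>a\<bar> = 1" for a
    using that u norm_Pair_le[of a u] mink_null_iff[of "(a, u)"]
    by (auto simp: lightlike_def zero_prod_def)
  have le: "\<bar>fst z\<bar> \<le> norm z" "norm (snd z) \<le> norm z"
    using norm_fst_le[of "fst z" "snd z"] norm_snd_le[of "snd z" "fst z"] by auto
  have bounds: "\<bar>(a + b) / 2\<bar> \<le> m \<and> \<bar>(a - b) / 2\<bar> \<le> m" if "0 \<le> a" "a \<le> m" "\<bar>b\<bar> \<le> m" for a b m :: real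
    using that by (auto simp: abs_le_iff)
  show ?thesis
  proof (rule that[of "(1, u)" "(-1, u)" "(norm (snd z) + fst z) / 2" "(norm (snd z) - fst z) / 2"])
    have "snd z = ((norm (snd z) + fst z) / 2) *\<^sub>R u + ((norm (snd z) - fst z) / 2) *\<^sub>R u"
      using z by (simp add: scaleR_left_distrib[symmetric] field_simps)
    then show "z = ((norm (snd z) + fst z) / 2) *\<^sub>R (1, u) + ((norm (snd z) - fst z) / 2) *\<^sub>R (-1, u)"
      by (auto simp: prod_eq_iff field_simps)
    show "\<bar>(norm (snd z) + fst z) / 2\<bar> \<le> norm z" "\<bar>(norm (snd z) - fst z) / 2\<bar> \<le> norm z"
      using bounds[OF norm_ge_zero le(2,1)] by simp_all
  qed (auto intro!: null)
qed

text \<open>Two null links suffice. The first has parameter radius D/2 and moves by at most D/4,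
  after which radius D/4 is still available. The costs 8 and 16 add up to 24, and D/8 is half the
  second radius.\<close>

lemma reach_local:
  assumes D: "0 < infdist x (-\<Omega>)" and near: "dist x y \<le> infdist x (-\<Omega>) / 8"
  shows "\<exists>l. reach \<Omega> x y l \<and> l \<le> 24 * dist x y / infdist x (-\<Omega>)"
proof -
  let ?D = "infdist x (-\<Omega>)" and ?r = "dist x y"
  obtain v w \<alpha> \<beta> where vw: "lightlike mink_form v" "lightlike mink_form w" "norm v \<le> 2" "norm w \<le> 2"
    and eq: "y - x = \<alpha> *\<^sub>R v + \<beta> *\<^sub>R w" and ab: "\<bar>\<alpha>\<bar> \<le> norm (y - x)" "\<bar>\<beta>\<bar> \<le> norm (y - x)"
    using null_decomposition by blast
  have r: "norm (y - x) = ?r" by (simp add: dist_norm norm_minus_commute)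
  define x' where "x' = x + \<alpha> *\<^sub>R v"
  have y: "y = x' + \<beta> *\<^sub>R w" using eq by (simp add: x'_def algebra_simps)
  have "?D / 2 * norm v \<le> ?D / 2 * 2" using D vw by (intro mult_left_mono) auto
  then obtain l where l: "lightlike_link \<Omega> x x' l" "l \<le> 4 * \<bar>\<alpha>\<bar> / (?D / 2)"
    using lightlike_link_ball[OF vw(1), of "?D / 2" \<alpha> x \<Omega>] D ab near r by (auto simp: x'_def)
  have "\<bar>\<alpha>\<bar> * norm v \<le> ?r * 2" using ab vw r by (intro mult_mono) auto
  then have "dist x x' \<le> ?D / 4" using near by (simp add: x'_def dist_norm)
  then have D': "?D / 2 \<le> infdist x' (-\<Omega>)" using infdist_triangle[of x "-\<Omega>" x'] D by simp
  have "?D / 4 * norm w \<le> ?D / 4 * 2" using D vw by (intro mult_left_mono) auto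
  then have "?D / 4 * norm w \<le> infdist x' (-\<Omega>)" using D' by linarith
  then obtain l' where l': "lightlike_link \<Omega> x' y l'" "l' \<le> 4 * \<bar>\<beta>\<bar> / (?D / 4)"
    using lightlike_link_ball[OF vw(2), of "?D / 4" \<beta> x' \<Omega>] D D' ab near r y by auto
  have "reach \<Omega> x y (l + l')" using reach.step[OF reach.link[OF l(1)] l'(1)] .
  moreover have "4 * \<bar>\<alpha>\<bar> / (?D / 2) \<le> 4 * ?r / (?D / 2)" "4 * \<bar>\<beta>\<bar> / (?D / 4) \<le> 4 * ?r / (?D / 4)"
    using ab r D by (auto intro!: divide_right_mono)
  then have "l + l' \<le> 24 * ?r / ?D" using l l' by simp
  ultimately show ?thesis by blast
qed

lemma reach_local_const:
  assumes "0 < infdist x (-\<Omega>)" and "dist x y \<le> infdist x (-\<Omega>) / 8"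
  shows "\<exists>l. reach \<Omega> x y l \<and> l \<le> 3"
proof -
  have "24 * dist x y / infdist x (-\<Omega>) \<le> 3" using assms by (simp add: field_simps)
  then show ?thesis using reach_local[OF assms] by force
qed

text \<open>Along a segment that moves away from the boundary at a definite rate, steps whose length is
  a fixed fraction of the distance to the boundary form a geometric progression.\<close>

lemma reach_cone_steps:
  fixes n :: nat
  assumes D: "0 < infdist x (-\<Omega>)" and \<kappa>: "0 < \<kappa>"
    and cone: "\<And>s. s \<in> {0..1} \<Longrightarrow> \<kappa> * (infdist x (-\<Omega>) + s * norm w) \<le> infdist (x + s *\<^sub>R w) (-\<Omega>)"
    and s: "s \<in> {0..1}" "infdist x (-\<Omega>) + s * norm w \<le> infdist x (-\<Omega>) * (1 + \<kappa> / 8) ^ n"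
  shows "\<exists>l. reach \<Omega> x (x + s *\<^sub>R w) l \<and> l \<le> 3 * (real n + 1)"
  using s
proof (induction n arbitrary: s)
  case 0
  then have "s * norm w = 0" by (smt (verit) atLeastAtMost_iff mult_cancel_left1 mult_nonneg_nonneg norm_ge_zero power_0 mult_1_right)
  then have "s *\<^sub>R w = 0" by auto
  then show ?case using reach_local_const[of x \<Omega> x] D by auto
next
  case (Suc n)
  let ?D = "infdist x (-\<Omega>)" and ?\<theta> = "1 + \<kappa> / 8"
  show ?case
  proof (cases "?D + s * norm w \<le> ?D * ?\<theta> ^ n")
    case True
    then show ?thesis using Suc by force
  next
    case False
    have "1 \<le> ?\<theta> ^ n" using \<kappa> by (intro one_le_power) simp
    then have "?D * 1 \<le> ?D * ?\<theta> ^ n" using D by (intro mult_left_mono) auto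
    then have sw: "0 < s * norm w" using False by linarith
    then have "0 < s" "0 < norm w" using Suc.prems by (auto simp: zero_less_mult_iff)
    \<comment> \<open>Here the scale D + s' |w| equals D * \<theta>^n. What remains is at most one
      factor \<theta>, hence at most 1/8 of the current height by the cone hypothesis.\<close>
    define s' where "s' = (?D * ?\<theta> ^ n - ?D) / norm w"
    have s'w: "?D + s' * norm w = ?D * ?\<theta> ^ n" using \<open>0 < norm w\<close> by (simp add: s'_def)
    have "0 \<le> s'" unfolding s'_def using \<open>?D * 1 \<le> ?D * ?\<theta> ^ n\<close> by (intro divide_nonneg_nonneg) auto
    have "s' * norm w < s * norm w" using s'w False by linarith
    then have "s' < s" using \<open>0 < norm w\<close> by simp
    then have s': "s' \<in> {0..1}" using \<open>0 \<le> s'\<close> Suc.prems by auto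
    obtain l where l: "reach \<Omega> x (x + s' *\<^sub>R w) l" "l \<le> 3 * (real n + 1)"
      using Suc.IH[OF s'] s'w by auto
    have "(s - s') * norm w \<le> ?D * ?\<theta> ^ n * ?\<theta> - ?D * ?\<theta> ^ n"
      using Suc.prems(2) s'w by (simp add: algebra_simps)
    also have "\<dots> = \<kappa> * (?D + s' * norm w) / 8" unfolding s'w by (simp add: algebra_simps)
    also have "\<dots> \<le> infdist (x + s' *\<^sub>R w) (-\<Omega>) / 8" using cone[OF s'] by simp
    also have "(s - s') * norm w = dist (x + s' *\<^sub>R w) (x + s *\<^sub>R w)"
      using \<open>s' < s\<close> by (simp add: dist_norm scaleR_left_diff_distrib[symmetric] abs_minus_commute)
    finally have near: "dist (x + s' *\<^sub>R w) (x + s *\<^sub>R w) \<le> infdist (x + s' *\<^sub>R w) (-\<Omega>) / 8" .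
    have "0 < \<kappa> * (?D + s' * norm w)" using \<kappa> D \<open>0 \<le> s'\<close> by (intro mult_pos_pos add_pos_nonneg) auto
    then have "0 < infdist (x + s' *\<^sub>R w) (-\<Omega>)" using cone[OF s'] by linarith
    then obtain l' where "reach \<Omega> (x + s' *\<^sub>R w) (x + s *\<^sub>R w) l'" "l' \<le> 3"
      using reach_local_const near by blast
    then show ?thesis using reach_trans[OF _ l(1), of "x + s *\<^sub>R w" l'] l(2)
      by (intro exI[of _ "l + l'"]) auto
  qed
qed

lemma reach_cone:
  assumes D: "0 < infdist x (-\<Omega>)" and \<kappa>: "0 < \<kappa>"
    and cone: "\<And>s. s \<in> {0..1} \<Longrightarrow> \<kappa> * (infdist x (-\<Omega>) + s * norm w) \<le> infdist (x + s *\<^sub>R w) (-\<Omega>)"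
  shows "\<exists>l. reach \<Omega> x (x + w) l \<and> l \<le> 6 + 3 / ln (1 + \<kappa> / 8) * ln (1 + norm w / infdist x (-\<Omega>))"
proof -
  let ?D = "infdist x (-\<Omega>)" and ?\<theta> = "1 + \<kappa> / 8"
  define L where "L = ln (1 + norm w / ?D) / ln ?\<theta>"
  define n where "n = nat \<lceil>L\<rceil>"
  have ln: "0 < ln ?\<theta>" using \<kappa> by simp
  have "0 \<le> L" unfolding L_def using ln D by (intro divide_nonneg_pos ln_ge_zero) auto
  then have n: "L \<le> real n" "real n \<le> L + 1" by (simp_all add: n_def real_nat_ceiling_ge)
  have "ln (1 + norm w / ?D) = L * ln ?\<theta>" using ln by (simp add: L_def)
  also have "\<dots> \<le> real n * ln ?\<theta>" using n ln by (intro mult_right_mono) auto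
  also have "\<dots> = ln (?\<theta> ^ n)" using \<kappa> by (simp add: ln_realpow)
  finally have "ln (1 + norm w / ?D) \<le> ln (?\<theta> ^ n)" .
  moreover have "0 < 1 + norm w / ?D" using D by (intro add_pos_nonneg) auto
  moreover have "0 < ?\<theta> ^ n" using \<kappa> by (intro zero_less_power) auto
  ultimately have "1 + norm w / ?D \<le> ?\<theta> ^ n" by simp
  then have "?D * (1 + norm w / ?D) \<le> ?D * ?\<theta> ^ n" using D by (intro mult_left_mono) auto
  then have "?D + 1 * norm w \<le> ?D * ?\<theta> ^ n" using D by (simp add: algebra_simps)
  then obtain l where "reach \<Omega> x (x + w) l" "l \<le> 3 * (real n + 1)"
    using reach_cone_steps[OF D \<kappa> cone, of 1 n] by auto
  moreover have "3 * (real n + 1) \<le> 6 + 3 * L" using n by simp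
  ultimately show ?thesis by (intro exI[of _ l]) (auto simp: L_def)
qed

text \<open>A uniform-domain condition with straight legs: height grows linearly along both legs,
  whose lengths are controlled by |x-y|, and their ends are close enough for
  \<open>reach_local_const\<close>.\<close>

definition cone_connected :: "'n::finite mink set \<Rightarrow> real \<Rightarrow> real \<Rightarrow> bool" where
  "cone_connected \<Omega> \<kappa> \<Lambda> \<longleftrightarrow> (\<forall>x\<in>\<Omega>. \<forall>y\<in>\<Omega>. \<exists>v w.
     norm v \<le> \<Lambda> * dist x y \<and> norm w \<le> \<Lambda> * dist x y \<and>
     (\<forall>s\<in>{0..1}. \<kappa> * (infdist x (-\<Omega>) + s * norm v) \<le> infdist (x + s *\<^sub>R v) (-\<Omega>)) \<and>
     (\<forall>s\<in>{0..1}. \<kappa> * (infdist y (-\<Omega>) + s * norm w) \<le> infdist (y + s *\<^sub>R w) (-\<Omega>)) \<and>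
     dist (x + v) (y + w) \<le> infdist (x + v) (-\<Omega>) / 8)"

lemma reach_upper:
  assumes pos: "\<And>x. x \<in> \<Omega> \<Longrightarrow> 0 < infdist x (-\<Omega>)" and \<kappa>: "0 < \<kappa>" and \<Lambda>: "0 \<le> \<Lambda>"
    and conn: "cone_connected \<Omega> \<kappa> \<Lambda>"
  obtains B where "0 < B" "\<And>x y. \<lbrakk>x \<in> \<Omega>; y \<in> \<Omega>\<rbrakk> \<Longrightarrow> \<exists>l. reach \<Omega> x y l \<and>
    l \<le> B + B * ln (1 + dist x y / min (infdist x (-\<Omega>)) (infdist y (-\<Omega>)))"
proof -
  define c where "c = 3 / ln (1 + \<kappa> / 8)"
  have "0 < c" using \<kappa> by (simp add: c_def)
  \<comment> \<open>15 = 6 + 6 + 3 collects the constants of the two legs and of the bridge between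
    their ends; the logarithm of 1 + \<Lambda> comes from 1 + \<Lambda> t <= (1 + \<Lambda>) (1 +
    t).\<close>
  define B where "B = 15 + 2 * c * ln (1 + \<Lambda>) + 2 * c"
  have "0 \<le> ln (1 + \<Lambda>)" using \<Lambda> by (intro ln_ge_zero) auto
  then have B: "0 < B" "2 * c \<le> B" "15 + 2 * c * ln (1 + \<Lambda>) \<le> B"
    using \<open>0 < c\<close> by (auto simp: B_def intro!: add_pos_nonneg)
  show ?thesis
  proof (rule that[OF B(1)])
    fix x y assume x: "x \<in> \<Omega>" and y: "y \<in> \<Omega>"
    define m where "m = min (infdist x (-\<Omega>)) (infdist y (-\<Omega>))"
    have "0 < m" using pos x y by (simp add: m_def)
    define J where "J = ln (1 + dist x y / m)"
    have "0 \<le> J" unfolding J_def using \<open>0 < m\<close> by (intro ln_ge_zero) auto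
    obtain v w where vw: "norm v \<le> \<Lambda> * dist x y" "norm w \<le> \<Lambda> * dist x y"
      and cone: "\<And>s. s \<in> {0..1} \<Longrightarrow> \<kappa> * (infdist x (-\<Omega>) + s * norm v) \<le> infdist (x + s *\<^sub>R v) (-\<Omega>)"
       "\<And>s. s \<in> {0..1} \<Longrightarrow> \<kappa> * (infdist y (-\<Omega>) + s * norm w) \<le> infdist (y + s *\<^sub>R w) (-\<Omega>)"
      and near: "dist (x + v) (y + w) \<le> infdist (x + v) (-\<Omega>) / 8"
      using conn x y unfolding cone_connected_def by blast
    have est: "c * ln (1 + norm u / infdist z (-\<Omega>)) \<le> c * (ln (1 + \<Lambda>) + J)"
      if "norm u \<le> \<Lambda> * dist x y" "m \<le> infdist z (-\<Omega>)" for u z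
    proof -
      have "norm u / infdist z (-\<Omega>) \<le> \<Lambda> * dist x y / m"
        using that \<open>0 < m\<close> \<Lambda> by (intro frac_le) auto
      moreover have "(1 + \<Lambda>) * (1 + dist x y / m) = 1 + \<Lambda> * dist x y / m + (\<Lambda> + dist x y / m)"
        by (simp add: algebra_simps add_divide_distrib)
      moreover have "0 \<le> \<Lambda> + dist x y / m" using \<Lambda> \<open>0 < m\<close> by simp
      ultimately have "1 + norm u / infdist z (-\<Omega>) \<le> (1 + \<Lambda>) * (1 + dist x y / m)" by linarith
      moreover have "0 < 1 + norm u / infdist z (-\<Omega>)"
        by (intro add_pos_nonneg) (auto simp: infdist_nonneg)
      ultimately have "ln (1 + norm u / infdist z (-\<Omega>)) \<le> ln ((1 + \<Lambda>) * (1 + dist x y / m))"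
        by (subst ln_le_cancel_iff) auto
      also have "\<dots> = ln (1 + \<Lambda>) + J"
        unfolding J_def using \<Lambda> \<open>0 < m\<close> by (intro ln_mult_pos add_pos_nonneg) auto
      finally show ?thesis using \<open>0 < c\<close> by simp
    qed
    obtain l1 where l1: "reach \<Omega> x (x + v) l1" "l1 \<le> 6 + c * (ln (1 + \<Lambda>) + J)"
      using reach_cone[OF pos[OF x] \<kappa> cone(1)] est[OF vw(1), of x] by (fastforce simp: c_def m_def)
    obtain l2 where l2: "reach \<Omega> y (y + w) l2" "l2 \<le> 6 + c * (ln (1 + \<Lambda>) + J)"
      using reach_cone[OF pos[OF y] \<kappa> cone(2)] est[OF vw(2), of y] by (fastforce simp: c_def m_def)
    obtain l3 where l3: "reach \<Omega> (x + v) (y + w) l3" "l3 \<le> 3"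
      using reach_local_const[OF pos near] reach_in[OF l1(1)] by blast
    have "reach \<Omega> x y (l1 + l3 + l2)"
      using reach_trans[OF reach_commute[OF l2(1)] reach_trans[OF l3(1) l1(1)]] .
    moreover have "l1 + l3 + l2 \<le> (15 + 2 * c * ln (1 + \<Lambda>)) + 2 * c * J"
      using l1(2) l2(2) l3(2) by (simp add: algebra_simps)
    moreover have "2 * c * J \<le> B * J" using B(2) \<open>0 \<le> J\<close> by (rule mult_right_mono)
    ultimately show "\<exists>l. reach \<Omega> x y l \<and>
        l \<le> B + B * ln (1 + dist x y / min (infdist x (-\<Omega>)) (infdist y (-\<Omega>)))"
      using B(3) by (intro exI[of _ "l1 + l3 + l2"]) (auto simp: J_def m_def)
  qed
qed

theorem markowitz_hyperbolic_criterion: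
  fixes \<Omega> :: "'n::finite mink set"
  assumes op: "open \<Omega>" "\<Omega> \<noteq> UNIV" and esc: "null_escape \<Omega> K"
    and conn: "cone_connected \<Omega> \<kappa> \<Lambda>" "0 < \<kappa>" "0 \<le> \<Lambda>"
  shows "gromov_hyperbolic \<Omega> (markowitz_dist \<Omega>)"
proof -
  let ?D = "\<lambda>x. infdist x (-\<Omega>)" and ?d = "markowitz_dist \<Omega>"
  note pos = infdist_compl_pos[OF op]
  obtain B where B: "0 < B" and upper: "\<And>x y. \<lbrakk>x \<in> \<Omega>; y \<in> \<Omega>\<rbrakk> \<Longrightarrow> \<exists>l. reach \<Omega> x y l \<and>
    l \<le> B + B * ln (1 + dist x y / min (?D x) (?D y))"
    using reach_upper[OF pos conn(2,3,1)] by blast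
  have ex: "\<exists>l. reach \<Omega> x y l" if "x \<in> \<Omega>" "y \<in> \<Omega>" for x y using upper that by blast
  \<comment> \<open>An integer, because \<open>reach_lower\<close> uses it as the exponent in
    Bernoulli's inequality.\<close>
  define n where "n = Suc (nat \<lceil>2 * K\<rceil>)"
  have n: "2 * K \<le> real n" "1 \<le> n" unfolding n_def using real_nat_ceiling_ge[of "2 * K"] by linarith+
  have lower: "dist x y \<le> ?D x * (exp (real n * ?d x y) - 1)" if x: "x \<in> \<Omega>" and y: "y \<in> \<Omega>" for x y
  proof -
    \<comment> \<open>Solved for the length, the chain bound no longer depends on the chain and
      passes to the infimum.\<close>
    have "ln (1 + dist x y / ?D x) / real n \<le> Inf {l. reach \<Omega> x y l}"
    proof (rule cInf_greatest)
      show "{l. reach \<Omega> x y l} \<noteq> {}" using ex[OF x y] by blast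
      fix l assume "l \<in> {l. reach \<Omega> x y l}"
      then have "dist x y / ?D x \<le> exp (real n * l) - 1"
        using reach_lower[OF esc n, of x y l] pos[OF x] by (simp add: field_simps)
      then have "ln (1 + dist x y / ?D x) \<le> ln (exp (real n * l))"
        using pos[OF x] by (subst ln_le_cancel_iff) (auto intro!: add_pos_nonneg)
      then show "ln (1 + dist x y / ?D x) / real n \<le> l" using n by (simp add: field_simps)
    qed
    then have "ln (1 + dist x y / ?D x) \<le> real n * ?d x y"
      using n x y by (simp add: markowitz_dist_reach field_simps)
    then have "exp (ln (1 + dist x y / ?D x)) \<le> exp (real n * ?d x y)" by simp
    moreover have "0 < 1 + dist x y / ?D x" using pos[OF x] by (intro add_pos_nonneg) auto
    ultimately have "1 + dist x y / ?D x \<le> exp (real n * ?d x y)" by simp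
    then show ?thesis using pos[OF x] by (simp add: field_simps)
  qed
  have local: "?d x y \<le> 24 * dist x y / ?D x" if "x \<in> \<Omega>" "dist x y \<le> ?D x / 8" for x y
    using reach_local[OF pos[OF that(1)] that(2)] markowitz_dist_le by (meson order_trans)
  have metric: "Metric_space \<Omega> ?d"
  proof
    show "0 \<le> ?d x y" for x y by (rule markowitz_dist_nonneg[OF ex])
    show "?d x y = ?d y x" for x y by (rule markowitz_dist_commute)
    show "?d x y = 0 \<longleftrightarrow> x = y" if "x \<in> \<Omega>" "y \<in> \<Omega>" for x y
    proof
      assume "?d x y = 0"
      then show "x = y" using lower[OF that] by simp
    next
      assume "x = y"
      then have "?d x y \<le> 0" using local[of x x] pos that by (simp add: less_imp_le)
      moreover have "0 \<le> ?d x y" by (rule markowitz_dist_nonneg[OF ex])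
      ultimately show "?d x y = 0" by simp
    qed
    show "?d x z \<le> ?d x y + ?d y z" if xyz: "x \<in> \<Omega>" "y \<in> \<Omega>" "z \<in> \<Omega>" for x y z
    proof (rule field_le_epsilon)
      fix e :: real assume "0 < e"
      then have "0 < e / 2" by simp
      have approx: "\<exists>l. reach \<Omega> a b l \<and> l < ?d a b + e / 2" if ab: "a \<in> \<Omega>" "b \<in> \<Omega>" for a b
        using ex[OF ab] markowitz_dist_approx[OF _ \<open>0 < e / 2\<close>] by (elim exE)
      obtain l l' where "reach \<Omega> x y l" "l < ?d x y + e / 2" "reach \<Omega> y z l'" "l' < ?d y z + e / 2"
        using approx[OF xyz(1,2)] approx[OF xyz(2,3)] by (elim exE conjE)
      then show "?d x z \<le> ?d x y + ?d y z + e"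
        using markowitz_dist_le[OF reach_trans[of \<Omega> y z l' x l]] by linarith
    qed
  qed
  have "quasihyperbolic \<Omega> ?d (real n) B 24"
  proof (intro quasihyperbolic.intro op metric B)
    show "0 < real n" "0 < (24::real)" using n by auto
    fix x y assume x: "x \<in> \<Omega>" and y: "y \<in> \<Omega>"
    show "dist x y \<le> ?D x * (exp (real n * ?d x y) - 1)" using lower x y by blast
    show "?d x y \<le> B + B * ln (1 + dist x y / min (?D x) (?D y))"
      using upper[OF x y] markowitz_dist_le by (meson order_trans)
    show "?d x y \<le> 24 * dist x y / ?D x" if "dist x y \<le> ?D x / 8" using local x that by blast
    fix e s :: real assume e: "0 < e" "0 \<le> s" "s \<le> ?d x y"
    obtain l where l: "reach \<Omega> x y l" "l < ?d x y + e"
      using ex[OF x y] markowitz_dist_approx[OF _ e(1)] by (elim exE) blast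
    then have "s \<le> l" using markowitz_dist_le[OF l(1)] e by linarith
    then obtain z where z: "reach \<Omega> x z s" "reach \<Omega> z y (l - s)" using reach_split[OF l(1)] e by blast
    then have "?d x z \<le> s" "?d z y \<le> ?d x y - s + e"
      using markowitz_dist_le[OF z(1)] markowitz_dist_le[OF z(2)] l by linarith+
    then show "\<exists>z\<in>\<Omega>. ?d x z \<le> s \<and> ?d z y \<le> ?d x y - s + e" using reach_in[OF z(1)] by blast
  qed
  then show ?thesis by (rule quasihyperbolic.hyperbolic)
qed

section \<open>Causality\<close>

lemma affine_piece:
  fixes \<gamma> :: "real \<Rightarrow> 'a::real_normed_vector"
  assumes eq: "\<And>t. t \<in> {a..b} \<Longrightarrow> \<gamma> t = z + t *\<^sub>R v" and "a < b"
  shows "smooth_curve_on {a..b} \<gamma>"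
    and "t \<in> {a..b} \<Longrightarrow> vector_derivative \<gamma> (at t within {a..b}) = v"
proof -
  have \<gamma>: "(\<gamma> has_vector_derivative v) (at t within {a..b})" if "t \<in> {a..b}" for t
  proof (rule has_vector_derivative_transform[OF that])
    show "((\<lambda>t. z + t *\<^sub>R v) has_vector_derivative v) (at t within {a..b})"
      by (auto intro!: derivative_eq_intros)
  qed (use eq in auto)
  define D where "D k = (if k = 0 then \<gamma> else if k = 1 then (\<lambda>_. v) else (\<lambda>_. 0))" for k :: nat
  have "(D k has_vector_derivative D (Suc k) t) (at t within {a..b})" if "t \<in> {a..b}" for k t
    using \<gamma>[OF that] by (auto simp: D_def)
  then show "smooth_curve_on {a..b} \<gamma>"
    unfolding smooth_curve_on_def by (intro exI[of _ D]) (auto simp: D_def)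
  show "vector_derivative \<gamma> (at t within {a..b}) = v" if "t \<in> {a..b}"
    using vector_derivative_within_cbox[of a b t \<gamma> v] \<gamma>[OF that] \<open>a < b\<close> that by simp
qed

text \<open>Two pieces cover all uses: the middle vertex is the point to be placed in \<Omega> by
  future completeness or causal convexity, and equal pieces give the straight segment that relates
  two points.\<close>

lemma broken_line:
  fixes x v w :: "'n::finite mink"
  assumes "P v" "P w"
  obtains \<gamma> where "piecewise_smooth_curve P \<gamma> 0 2" "\<gamma> 0 = x" "\<gamma> 1 = x + v" "\<gamma> 2 = x + v + w"
proof
  define \<gamma> where "\<gamma> t = (if t \<le> 1 then x + t *\<^sub>R v else x + v + (t - 1) *\<^sub>R w)" for t :: real
  show "\<gamma> 0 = x" "\<gamma> 1 = x + v" "\<gamma> 2 = x + v + w" by (simp_all add: \<gamma>_def)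
  have p1: "\<gamma> t = x + t *\<^sub>R v" if "t \<in> {0..1}" for t using that by (simp add: \<gamma>_def)
  have p2: "\<gamma> t = (x + v - w) + t *\<^sub>R w" if "t \<in> {1..2}" for t
    using that by (auto simp: \<gamma>_def algebra_simps)
  note a1 = affine_piece[of 0 1 \<gamma> x v, OF p1] and a2 = affine_piece[of 1 2 \<gamma> "x + v - w" w, OF p2]
  show "piecewise_smooth_curve P \<gamma> 0 2"
    unfolding piecewise_smooth_curve_def
  proof (intro exI[of _ 2] exI[of _ real] conjI allI impI)
    fix i :: nat assume "i < 2"
    then have i: "i = 0 \<or> i = 1" by auto
    then show "real i < real (Suc i)" "smooth_curve_on {real i..real (Suc i)} \<gamma>"
      using a1(1) a2(1) by auto
    show "\<forall>t\<in>{real i..real (Suc i)}. P (vector_derivative \<gamma> (at t within {real i..real (Suc i)}))"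
      using i a1(2) a2(2) assms by auto
  qed auto
qed

lemma mink_form_eps_0: "mink_form = mink_form_eps 0"
  by (intro ext) (simp add: mink_form_def mink_form_eps_def)

lemma future_causal_vecI:
  assumes "0 \<le> \<epsilon>" "0 < fst v" "norm (snd v) \<le> (1 + \<epsilon>) * fst v"
  shows "future_causal_vec (mink_form_eps \<epsilon>) v"
proof -
  have "(norm (snd v))\<^sup>2 \<le> ((1 + \<epsilon>) * fst v)\<^sup>2" using assms(3) by (intro power_mono) auto
  then have "mink_form_eps \<epsilon> v v \<le> 0"
    by (simp add: mink_form_eps_def dot_square_norm power2_eq_square mult_ac)
  then show ?thesis
    using assms by (auto simp: future_causal_vec_def causal_vec_def mink_form_eps_def time_vec_def zero_less_mult_iff)
qed

lemma future_complete_add: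
  assumes "future_complete \<Omega>" "x \<in> \<Omega>" "0 < fst v" "norm (snd v) \<le> fst v"
  shows "x + v \<in> \<Omega>"
proof -
  have v: "future_causal_vec mink_form v" using future_causal_vecI[of 0 v] assms by (simp add: mink_form_eps_0)
  obtain \<gamma> where \<gamma>: "piecewise_smooth_curve (future_causal_vec mink_form) \<gamma> 0 2" "\<gamma> 0 = x" "\<gamma> 1 = x + v"
    using broken_line[of "future_causal_vec mink_form" v v x] v by metis
  then have "\<gamma> ` {0..2} \<subseteq> \<Omega>"
    using assms(1,2) unfolding future_complete_def future_causal_curve_def by metis
  moreover have "\<gamma> 1 \<in> \<gamma> ` {0..2}" by (intro imageI) simp
  ultimately show ?thesis using \<gamma>(3) by auto
qed

lemma causally_convex_between:
  assumes "causally_convex \<Omega>" "x \<in> \<Omega>" "x + v + w \<in> \<Omega>" "0 < fst v" "norm (snd v) \<le> fst v"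
    "0 < fst w" "norm (snd w) \<le> fst w"
  shows "x + v \<in> \<Omega>"
proof -
  have vw: "future_causal_vec mink_form v" "future_causal_vec mink_form w"
    using future_causal_vecI[of 0 v] future_causal_vecI[of 0 w] assms by (simp_all add: mink_form_eps_0)
  obtain \<gamma> where \<gamma>: "piecewise_smooth_curve (future_causal_vec mink_form) \<gamma> 0 2" "\<gamma> 0 = x" "\<gamma> 1 = x + v"
      "\<gamma> 2 = x + v + w"
    using broken_line[of "future_causal_vec mink_form" v w x] vw by metis
  then have "\<gamma> ` {0..2} \<subseteq> \<Omega>"
    using assms(1-3) unfolding causally_convex_def causal_curve_def future_causal_curve_def by metis
  moreover have "\<gamma> 1 \<in> \<gamma> ` {0..2}" by (intro imageI) simp
  ultimately show ?thesis using \<gamma>(3) by auto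
qed

text \<open>Were the time difference larger, the straight segment between the two points would be
  causal for the wider cones.\<close>

lemma eps_stably_acausal_slope:
  assumes S: "eps_stably_acausal \<epsilon> S" "0 \<le> \<epsilon>" and xy: "x \<in> S" "y \<in> S"
  shows "(1 + \<epsilon>) * \<bar>fst x - fst y\<bar> \<le> norm (snd x - snd y)"
proof -
  have *: "(1 + \<epsilon>) * (fst y - fst x) \<le> norm (snd x - snd y)" if xy: "x \<in> S" "y \<in> S" for x y
  proof (rule ccontr)
    assume neg: "\<not> ?thesis"
    have "0 \<le> norm (snd x - snd y)" by simp
    then have "0 < (1 + \<epsilon>) * (fst y - fst x)" using neg by linarith
    then have lt: "0 < fst y - fst x" using S(2) by (auto simp: zero_less_mult_iff)
    then have "x \<noteq> y" by auto
    \<comment> \<open>Half the difference, since \<open>broken_line\<close> concatenates two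
      pieces.\<close>
    define v where "v = (1 / 2) *\<^sub>R (y - x)"
    have "2 * norm (snd v) = norm (snd y - snd x)" unfolding v_def snd_scaleR norm_scaleR by simp
    moreover have fstv: "2 * fst v = fst y - fst x" by (simp add: v_def)
    then have "2 * ((1 + \<epsilon>) * fst v) = (1 + \<epsilon>) * (fst y - fst x)" by simp
    ultimately have "norm (snd v) \<le> (1 + \<epsilon>) * fst v"
      using neg norm_minus_commute[of "snd x" "snd y"] by linarith
    then have "future_causal_vec (mink_form_eps \<epsilon>) v"
      using lt S(2) fstv by (intro future_causal_vecI) auto
    then obtain \<gamma> where "piecewise_smooth_curve (future_causal_vec (mink_form_eps \<epsilon>)) \<gamma> 0 2"
      "\<gamma> 0 = x" "\<gamma> 2 = x + v + v" using broken_line[of _ v v x] by metis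
    moreover have "x + v + v = y" by (simp add: v_def scaleR_2[symmetric] add.assoc)
    ultimately have "causally_related (mink_form_eps \<epsilon>) x y"
      unfolding causally_related_def causal_curve_def future_causal_curve_def by blast
    then show False using S(1) xy \<open>x \<noteq> y\<close> unfolding eps_stably_acausal_def by blast
  qed
  show ?thesis
  proof (cases "fst x \<le> fst y")
    case True
    then show ?thesis using *[OF xy] by simp
  next
    case False
    then show ?thesis using *[OF xy(2,1)] by (simp add: norm_minus_commute)
  qed
qed

lemma norm_fst_snd: "\<bar>fst z\<bar> \<le> norm z" "norm (snd z) \<le> norm z" for z :: "'n::finite mink"
  using norm_fst_le[of "fst z" "snd z"] norm_snd_le[of "snd z" "fst z"] by simp_all

section \<open>Future complete domains\<close>

text \<open>\<open>z\<close> is a boundary point near \<open>p\<close>, and \<open>z'\<close> one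
  lying a further time \<open>h\<close> beyond the end of the null ray. They differ by at least
  \<tau> - r in time and at most \<tau> + r in space, so the slope bound yields (1 + \<epsilon>)
  (\<tau> - r) <= \<tau> + r.\<close>

lemma escape_time_bound:
  fixes p w z z' :: "'n::finite mink"
  assumes \<epsilon>: "0 < \<epsilon>" and w: "lightlike mink_form w" "fst w = 1" and \<sigma>: "\<sigma> = 1 \<or> \<sigma> = -1"
    and "0 \<le> \<tau>" "0 \<le> h"
    and z: "dist p z \<le> r"
    and z': "z' = p + (\<sigma> * \<tau>) *\<^sub>R w + (\<sigma> * h, 0)"
    and slope: "(1 + \<epsilon>) * \<bar>fst z - fst z'\<bar> \<le> norm (snd z - snd z')"
  shows "\<tau> \<le> (2 + \<epsilon>) / \<epsilon> * r"
proof -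
  have nw: "norm (snd w) = 1" using w mink_null_iff[of w] by (simp add: lightlike_def)
  have le: "\<bar>fst p - fst z\<bar> \<le> r" "norm (snd p - snd z) \<le> r"
    using z norm_fst_snd[of "p - z"] by (simp_all add: dist_norm)
  have "norm (snd z - (snd p + (\<sigma> * \<tau>) *\<^sub>R snd w)) \<le> norm (snd p - snd z) + norm ((\<sigma> * \<tau>) *\<^sub>R snd w)"
    using norm_triangle_ineq4[of "snd z - snd p" "(\<sigma> * \<tau>) *\<^sub>R snd w"]
    by (simp add: norm_minus_commute diff_diff_eq)
  also have "\<dots> \<le> r + \<tau>" using le \<sigma> nw \<open>0 \<le> \<tau>\<close> by auto
  finally have up: "norm (snd z - (snd p + (\<sigma> * \<tau>) *\<^sub>R snd w)) \<le> r + \<tau>" .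
  have "\<tau> - r \<le> \<bar>fst z - (fst p + \<sigma> * \<tau> + \<sigma> * h)\<bar>"
    using \<sigma>
  proof
    assume "\<sigma> = 1"
    then show ?thesis using le(1) \<open>0 \<le> h\<close> by (simp add: abs_le_iff) linarith
  next
    assume "\<sigma> = -1"
    then show ?thesis using le(1) \<open>0 \<le> h\<close> by (simp add: abs_le_iff) linarith
  qed
  then have "(1 + \<epsilon>) * (\<tau> - r) \<le> (1 + \<epsilon>) * \<bar>fst z - (fst p + \<sigma> * \<tau> + \<sigma> * h)\<bar>"
    using \<epsilon> by (intro mult_left_mono) auto
  also have "\<dots> \<le> r + \<tau>" using slope up w(2) by (simp add: z')
  finally have "\<epsilon> * \<tau> \<le> (2 + \<epsilon>) * r" by (simp add: algebra_simps)
  then show ?thesis using \<epsilon> by (simp add: field_simps)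
qed

lemma frontier_within_infdist:
  fixes \<Omega> :: "'n::finite mink set"
  assumes "p \<in> \<Omega>" "open \<Omega>" "\<Omega> \<noteq> UNIV"
  obtains z where "z \<in> frontier \<Omega>" "dist p z \<le> infdist p (-\<Omega>)"
proof -
  obtain y where y: "y \<notin> \<Omega>" "infdist p (-\<Omega>) = dist p y"
    using infdist_compl_attained[OF assms(2,3)] by blast
  have "closed_segment p y \<inter> frontier \<Omega> \<noteq> {}"
    using assms(1) y by (intro connected_Int_frontier) auto
  then obtain z where z: "z \<in> closed_segment p y" "z \<in> frontier \<Omega>" by blast
  then have "dist p z \<le> dist p y" using segment_bound(1)[OF z(1)] by (simp add: dist_norm norm_minus_commute)
  then show ?thesis using that z y by simp
qed

text \<open>The direction is always the past. Below the end \<open>q\<close> of the ray lies a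
  boundary point, since otherwise the vertical line down from \<open>q\<close> would stay in
  \<Omega> and its future would contain \<open>z\<close>.\<close>

lemma future_complete_null_escape:
  fixes \<Omega> :: "'n::finite mink set"
  assumes op: "open \<Omega>" "\<Omega> \<noteq> UNIV" and fc: "future_complete \<Omega>"
    and \<epsilon>: "0 < \<epsilon>" "eps_stably_acausal \<epsilon> (frontier \<Omega>)"
  shows "null_escape \<Omega> ((2 + \<epsilon>) / \<epsilon>)"
  unfolding null_escape_def
proof (intro ballI bexI[of _ "-1"] allI impI; (elim conjE)?)
  fix p w :: "'n mink" and \<tau> :: real
  assume p: "p \<in> \<Omega>" and w: "lightlike mink_form w" "fst w = 1" and "0 \<le> \<tau>"
    and in\<Omega>: "p + (-1 * \<tau>) *\<^sub>R w \<in> \<Omega>"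
  define q where "q = p + (-1 * \<tau>) *\<^sub>R w"
  obtain z where z: "z \<in> frontier \<Omega>" "dist p z \<le> infdist p (-\<Omega>)"
    using frontier_within_infdist[OF p op] by blast
  have "z \<notin> \<Omega>" using z(1) op(1) by (simp add: frontier_def interior_open)
  \<comment> \<open>Large enough that \<open>z\<close> lies in the open future cone of the point
    \<open>H\<close> below \<open>q\<close>.\<close>
  define H where "H = norm (snd z - snd q) + \<bar>fst z - fst q\<bar> + 1"
  have "0 \<le> H" by (simp add: H_def)
  have "q + (- H, 0) \<notin> \<Omega>"
  proof
    assume *: "q + (- H, 0) \<in> \<Omega>"
    let ?v = "z - (q + (- H, 0))"
    have "norm (snd ?v) < fst ?v" by (simp add: H_def)
    moreover from this have "0 < fst ?v" using norm_ge_zero[of "snd ?v"] by linarith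
    ultimately have "(q + (- H, 0)) + ?v \<in> \<Omega>" by (intro future_complete_add[OF fc *]) auto
    then show False using \<open>z \<notin> \<Omega>\<close> by simp
  qed
  then have "closed_segment q (q + (- H, 0)) \<inter> frontier \<Omega> \<noteq> {}"
    using in\<Omega> by (intro connected_Int_frontier) (auto simp: q_def)
  then obtain z' where z': "z' \<in> closed_segment q (q + (- H, 0))" "z' \<in> frontier \<Omega>" by blast
  then obtain u where u: "0 \<le> u" "z' = (1 - u) *\<^sub>R q + u *\<^sub>R (q + (- H, 0))"
    unfolding closed_segment_def by blast
  then have z'_eq: "z' = p + (-1 * \<tau>) *\<^sub>R w + (-1 * (u * H), 0)"
    by (simp add: q_def algebra_simps)
  have "(1 + \<epsilon>) * \<bar>fst z - fst z'\<bar> \<le> norm (snd z - snd z')"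
    using eps_stably_acausal_slope[OF \<epsilon>(2) _ z(1) z'(2)] \<epsilon>(1) by simp
  then show "\<tau> \<le> (2 + \<epsilon>) / \<epsilon> * infdist p (-\<Omega>)"
    using u(1) \<open>0 \<le> H\<close> by (intro escape_time_bound[OF \<epsilon>(1) w _ \<open>0 \<le> \<tau>\<close> _ z(2) z'_eq]) auto
qed simp

lemma future_complete_cone_connected:
  fixes \<Omega> :: "'n::finite mink set"
  assumes op: "open \<Omega>" "\<Omega> \<noteq> UNIV" and fc: "future_complete \<Omega>"
  shows "cone_connected \<Omega> (1 / 2) 16"
proof -
  \<comment> \<open>A displacement \<open>u\<close> of the raised point is split in the ratio D : a.
    The first part keeps \<open>x\<close> in its ball; the second has norm at most a/2 and leaves
    the vertical vector of length \<open>a\<close> future causal.\<close>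
  have rise: "(infdist x (-\<Omega>) + a) / 2 \<le> infdist (x + (a, 0)) (-\<Omega>)" if "0 \<le> a" "x \<in> \<Omega>" for a x
  proof (rule ccontr)
    let ?D = "infdist x (-\<Omega>)" and ?y = "x + (a, 0)"
    assume neg: "\<not> ?thesis"
    obtain z where z: "z \<notin> \<Omega>" "infdist ?y (-\<Omega>) = dist ?y z"
      using infdist_compl_attained[OF op] by blast
    have "0 < ?D" by (rule infdist_compl_pos[OF op that(2)])
    then have M: "0 < ?D + a" using that by simp
    define u where "u = z - ?y"
    have u: "norm u < (?D + a) / 2" using neg z by (simp add: u_def dist_norm norm_minus_commute)
    have scaled: "norm ((b / (?D + a)) *\<^sub>R u) \<le> b / 2" if "0 \<le> b" for b
    proof -
      have "b / (?D + a) * norm u \<le> b / (?D + a) * ((?D + a) / 2)"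
        using u M that by (intro mult_left_mono) auto
      then show ?thesis using M that by simp
    qed
    have x1: "x + (?D / (?D + a)) *\<^sub>R u \<in> \<Omega>"
    proof (rule infdist_compl_ball)
      have "norm ((?D / (?D + a)) *\<^sub>R u) < ?D" using scaled[of ?D] \<open>0 < ?D\<close> by linarith
      then show "dist x (x + (?D / (?D + a)) *\<^sub>R u) < ?D" unfolding dist_norm by simp
    qed
    have eq: "z = (x + (?D / (?D + a)) *\<^sub>R u) + ((a, 0) + (a / (?D + a)) *\<^sub>R u)"
    proof -
      have "(?D / (?D + a)) *\<^sub>R u + (a / (?D + a)) *\<^sub>R u = u"
        using M by (simp add: scaleR_left_distrib[symmetric] add_divide_distrib[symmetric])
      then show ?thesis by (simp add: u_def algebra_simps)
    qed
    show False
    proof (cases "a = 0")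
      case True
      then show False using eq x1 z by (simp add: zero_prod_def[symmetric])
    next
      case False
      define e where "e = (a / (?D + a)) *\<^sub>R u"
      have "norm e \<le> a / 2" unfolding e_def by (rule scaled[OF that(1)])
      then have "\<bar>fst e\<bar> \<le> a / 2" "norm (snd e) \<le> a / 2"
        using norm_fst_snd[of e] by simp_all
      then have "z \<in> \<Omega>" unfolding eq e_def[symmetric] using False that(1)
        by (intro future_complete_add[OF fc x1]) (auto simp: abs_le_iff)
      then show False using z by simp
    qed
  qed
  show ?thesis
    unfolding cone_connected_def
  proof (intro ballI)
    fix x y assume x: "x \<in> \<Omega>" and y: "y \<in> \<Omega>"
    \<comment> \<open>With the rate 1/2 of \<open>rise\<close>, the factor 16 gives height at least
      8|x-y|. Translating both points by the same vector preserves their distance.\<close>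
    define v :: "'n mink" where "v = (16 * dist x y, 0)"
    have nv: "norm v = 16 * dist x y" by (auto simp: v_def norm_Pair power_mult_distrib intro!: real_sqrt_unique)
    have cone: "1 / 2 * (infdist z (-\<Omega>) + s * norm v) \<le> infdist (z + s *\<^sub>R v) (-\<Omega>)"
      if "s \<in> {0..1}" "z \<in> \<Omega>" for s z
      using rise[of "s * (16 * dist x y)" z] that by (simp add: nv) (simp add: v_def)
    have "dist (x + v) (y + v) \<le> infdist (x + v) (-\<Omega>) / 8"
      using cone[of 1 x] x nv infdist_nonneg[of x "-\<Omega>"] by simp
    then show "\<exists>v w. norm v \<le> 16 * dist x y \<and> norm w \<le> 16 * dist x y \<and>
     (\<forall>s\<in>{0..1}. 1 / 2 * (infdist x (-\<Omega>) + s * norm v) \<le> infdist (x + s *\<^sub>R v) (-\<Omega>)) \<and>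
     (\<forall>s\<in>{0..1}. 1 / 2 * (infdist y (-\<Omega>) + s * norm w) \<le> infdist (y + s *\<^sub>R w) (-\<Omega>)) \<and>
     dist (x + v) (y + w) \<le> infdist (x + v) (-\<Omega>) / 8"
      using cone x y nv by (intro exI[of _ v]) simp
  qed
qed

section \<open>Bounded convex domains\<close>

text \<open>Convex combinations of the balls around \<open>x\<close> and \<open>c\<close> fill the
  ball of the interpolated radius: a displacement \<open>u\<close> is distributed in the ratio of
  the two heights.\<close>

lemma infdist_compl_concave:
  fixes \<Omega> :: "'n::finite mink set"
  assumes "convex \<Omega>" "\<Omega> \<noteq> UNIV" "x \<in> \<Omega>" "c \<in> \<Omega>" "s \<in> {0..1}" "open \<Omega>"
  shows "(1 - s) * infdist x (-\<Omega>) + s * infdist c (-\<Omega>) \<le> infdist (x + s *\<^sub>R (c - x)) (-\<Omega>)"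
proof (rule ccontr)
  let ?D = "\<lambda>x. infdist x (-\<Omega>)" and ?m = "x + s *\<^sub>R (c - x)"
  assume neg: "\<not> ?thesis"
  define M where "M = (1 - s) * ?D x + s * ?D c"
  obtain z where z: "z \<notin> \<Omega>" "?D ?m = dist ?m z"
    using infdist_compl_attained[OF assms(6,2)] by blast
  note pos = infdist_compl_pos[OF assms(6,2)]
  define u where "u = z - ?m"
  have u: "norm u < M" using neg z by (simp add: u_def M_def dist_norm norm_minus_commute)
  then have "0 < M" using norm_ge_zero[of u] by linarith
  have in\<Omega>: "a + (?D a / M) *\<^sub>R u \<in> \<Omega>" if "a \<in> \<Omega>" for a
  proof (rule infdist_compl_ball)
    have "?D a / M * norm u < ?D a / M * M" using u \<open>0 < M\<close> pos[OF that] by (intro mult_strict_left_mono) auto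
    then show "dist a (a + (?D a / M) *\<^sub>R u) < ?D a" using \<open>0 < M\<close> pos[OF that] by (simp add: dist_norm)
  qed
  have "(1 - s) *\<^sub>R (x + (?D x / M) *\<^sub>R u) + s *\<^sub>R (c + (?D c / M) *\<^sub>R u)
      = ?m + (((1 - s) * ?D x + s * ?D c) / M) *\<^sub>R u"
    by (simp add: algebra_simps add_divide_distrib diff_divide_distrib)
  also have "\<dots> = z" using \<open>0 < M\<close> by (simp add: M_def[symmetric] u_def)
  finally have "z \<in> \<Omega>"
    using convexD_alt[OF assms(1) in\<Omega>[OF assms(3)] in\<Omega>[OF assms(4)], of s] assms(5) by auto
  then show False using z by simp
qed

lemma convex_cone_connected:
  fixes \<Omega> :: "'n::finite mink set"
  assumes "open \<Omega>" "bounded \<Omega>" "convex \<Omega>" "\<Omega> \<noteq> {}"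
  obtains \<kappa> \<Lambda> where "0 < \<kappa>" "0 \<le> \<Lambda>" "cone_connected \<Omega> \<kappa> \<Lambda>"
proof -
  let ?D = "\<lambda>x. infdist x (-\<Omega>)"
  have ne: "\<Omega> \<noteq> UNIV" using assms(2) not_bounded_UNIV by metis
  obtain c where c: "c \<in> \<Omega>" using assms(4) by blast
  define \<rho> where "\<rho> = ?D c"
  have "0 < \<rho>" unfolding \<rho>_def by (rule infdist_compl_pos[OF assms(1) ne c])
  obtain R0 where R0: "\<And>x. x \<in> \<Omega> \<Longrightarrow> dist c x \<le> R0" using assms(2) bounded_any_center[of \<Omega> c] by auto
  define R where "R = max \<rho> R0"
  have R: "0 < R" "\<rho> \<le> R" "\<And>x. x \<in> \<Omega> \<Longrightarrow> norm (c - x) \<le> R"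
    using R0 \<open>0 < \<rho>\<close> by (auto simp: R_def dist_norm le_max_iff_disj)
  have DR: "?D x \<le> 2 * R" if "x \<in> \<Omega>" for x
    using infdist_triangle[of x "-\<Omega>" c] R(2) R(3)[OF that] by (simp add: \<rho>_def dist_norm norm_minus_commute)
  \<comment> \<open>Heights are at most 2R and distances to the centre at most R, so the choice uses
    up 3/4 of the gain s\<rho>; R >= \<rho> keeps \<kappa> below 1.\<close>
  define \<kappa> where "\<kappa> = \<rho> / (4 * R)"
  have \<kappa>: "0 < \<kappa>" "\<kappa> \<le> 1" using R \<open>0 < \<rho>\<close> by (auto simp: \<kappa>_def field_simps)
  have \<kappa>R: "\<kappa> * R = \<rho> / 4" using R by (simp add: \<kappa>_def)
  have toward: "\<kappa> * (?D x + s * norm (c - x)) \<le> ?D (x + s *\<^sub>R (c - x))"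
    "s * \<rho> \<le> ?D (x + s *\<^sub>R (c - x))" if x: "x \<in> \<Omega>" and s: "s \<in> {0..1}" for x s
  proof -
    have conc: "(1 - s) * ?D x + s * \<rho> \<le> ?D (x + s *\<^sub>R (c - x))"
      unfolding \<rho>_def by (rule infdist_compl_concave[OF assms(3) ne x c s assms(1)])
    have "0 \<le> (1 - s) * ?D x" using s by (simp add: infdist_nonneg)
    then show "s * \<rho> \<le> ?D (x + s *\<^sub>R (c - x))" using conc by linarith
    have "\<kappa> * (?D x + s * norm (c - x)) = (1 - s) * (\<kappa> * ?D x) + s * (\<kappa> * ?D x) + s * (\<kappa> * norm (c - x))"
      by (simp add: algebra_simps)
    also have "\<dots> \<le> (1 - s) * (1 * ?D x) + s * (\<kappa> * (2 * R)) + s * (\<kappa> * R)"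
      using s \<kappa> DR[OF x] R(3)[OF x]
      by (intro add_mono mult_left_mono mult_right_mono) (auto simp: infdist_nonneg)
    also have "s * (\<kappa> * (2 * R)) = s * \<rho> / 2" using \<kappa>R by simp
    also have "s * (\<kappa> * R) = s * \<rho> / 4" using \<kappa>R by simp
    also have "(1 - s) * (1 * ?D x) + s * \<rho> / 2 + s * \<rho> / 4 \<le> (1 - s) * ?D x + s * \<rho>"
      using s \<open>0 < \<rho>\<close> by simp
    finally have "\<kappa> * (?D x + s * norm (c - x)) \<le> (1 - s) * ?D x + s * \<rho>" .
    then show "\<kappa> * (?D x + s * norm (c - x)) \<le> ?D (x + s *\<^sub>R (c - x))" using conc by linarith
  qed
  show ?thesis
  proof (rule that[OF \<kappa>(1), of "8 * R / \<rho>"])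
    show "0 \<le> 8 * R / \<rho>" using R \<open>0 < \<rho>\<close> by simp
    show "cone_connected \<Omega> \<kappa> (8 * R / \<rho>)"
      unfolding cone_connected_def
    proof (intro ballI)
      fix x y assume x: "x \<in> \<Omega>" and y: "y \<in> \<Omega>"
      \<comment> \<open>Moving both points by the fraction \<open>a\<close> towards \<open>c\<close>
        gives height at least \<open>a * \<rho>\<close>, which must be 8 times their remaining
        distance. At the cap 1 both legs end in \<open>c\<close>.\<close>
      define a where "a = min 1 (8 * dist x y / \<rho>)"
      have a: "0 \<le> a" "a \<le> 1" "a \<le> 8 * dist x y / \<rho>" using \<open>0 < \<rho>\<close> by (auto simp: a_def)
      have short: "norm (a *\<^sub>R (c - z)) \<le> 8 * R / \<rho> * dist x y" if "z \<in> \<Omega>" for z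
      proof -
        have "a * norm (c - z) \<le> 8 * dist x y / \<rho> * R" using a R(3)[OF that] R(1) \<open>0 < \<rho>\<close>
          by (intro mult_mono) auto
        then show ?thesis using a by (simp add: mult_ac)
      qed
      have cone: "\<kappa> * (?D z + s * norm (a *\<^sub>R (c - z))) \<le> ?D (z + s *\<^sub>R a *\<^sub>R (c - z))"
        if "s \<in> {0..1}" "z \<in> \<Omega>" for s z
        using toward(1)[OF that(2), of "s * a"] that(1) a mult_le_one[of s a] by (simp add: mult.assoc)
      have "(x + a *\<^sub>R (c - x)) - (y + a *\<^sub>R (c - y)) = (1 - a) *\<^sub>R (x - y)" by (simp add: algebra_simps)
      then have "dist (x + a *\<^sub>R (c - x)) (y + a *\<^sub>R (c - y)) = (1 - a) * dist x y"
        using a by (simp add: dist_norm)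
      also have "\<dots> \<le> a * \<rho> / 8"
      proof (cases "a = 1")
        case True
        then show ?thesis using \<open>0 < \<rho>\<close> by simp
      next
        case False
        then have "a * \<rho> = 8 * dist x y" using \<open>0 < \<rho>\<close> by (auto simp: a_def min_def split: if_splits)
        moreover have "(1 - a) * dist x y \<le> 1 * dist x y" using a by (intro mult_right_mono) auto
        ultimately show ?thesis by simp
      qed
      also have "\<dots> \<le> ?D (x + a *\<^sub>R (c - x)) / 8" using toward(2)[OF x, of a] a by simp
      finally have "dist (x + a *\<^sub>R (c - x)) (y + a *\<^sub>R (c - y)) \<le> ?D (x + a *\<^sub>R (c - x)) / 8" .
      then show "\<exists>v w. norm v \<le> 8 * R / \<rho> * dist x y \<and> norm w \<le> 8 * R / \<rho> * dist x y \<and>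
          (\<forall>s\<in>{0..1}. \<kappa> * (?D x + s * norm v) \<le> ?D (x + s *\<^sub>R v)) \<and>
          (\<forall>s\<in>{0..1}. \<kappa> * (?D y + s * norm w) \<le> ?D (y + s *\<^sub>R w)) \<and>
          dist (x + v) (y + w) \<le> ?D (x + v) / 8"
        using short[OF x] short[OF y] cone[OF _ x] cone[OF _ y]
        by (intro exI[of _ "a *\<^sub>R (c - x)"] exI[of _ "a *\<^sub>R (c - y)"] conjI ballI)
    qed
  qed
qed

text \<open>Taking the envelopes of all the light cones issued from \<open>\<Omega>\<close> yields functions that are
  1-Lipschitz on the whole space, so that no extension to the closure of \<open>U\<close> is needed.\<close>

lemma bounded_causal_representation:
  fixes \<Omega> :: "'n::finite mink set"
  assumes "open \<Omega>" "bounded \<Omega>" "causally_convex \<Omega>" "\<Omega> \<noteq> {}"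
  obtains f g :: "real ^ 'n \<Rightarrow> real" where
    "continuous_on UNIV f" "continuous_on UNIV g" "\<Omega> = {x. f (snd x) < fst x \<and> fst x < g (snd x)}"
    "causal_representation \<Omega> {p. f p < g p} (\<lambda>p. ereal (f p)) (\<lambda>p. ereal (g p))"
proof -
  define g where "g p = (SUP x\<in>\<Omega>. fst x - dist p (snd x))" for p
  define f where "f p = (INF x\<in>\<Omega>. fst x + dist p (snd x))" for p
  obtain R where R: "\<And>x. x \<in> \<Omega> \<Longrightarrow> norm x \<le> R" using assms(2) bounded_iff by blast
  have fst: "\<bar>fst x\<bar> \<le> R" if "x \<in> \<Omega>" for x
    using R[OF that] norm_fst_snd(1)[of x] by simp
  have bddg: "bdd_above ((\<lambda>x. fst x - dist p (snd x)) ` \<Omega>)" for p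
    using fst by (intro bdd_aboveI2[of _ _ R]) (smt (verit) zero_le_dist)
  have bddf: "bdd_below ((\<lambda>x. fst x + dist p (snd x)) ` \<Omega>)" for p
    using fst by (intro bdd_belowI2[of _ "-R"]) (smt (verit) zero_le_dist)
  have g_ge: "fst x - dist p (snd x) \<le> g p" if "x \<in> \<Omega>" for x p
    unfolding g_def by (rule cSUP_upper[OF that bddg])
  have f_le: "f p \<le> fst x + dist p (snd x)" if "x \<in> \<Omega>" for x p
    unfolding f_def by (rule cINF_lower[OF bddf that])
  have glip: "g p \<le> g q + dist p q" for p q
    unfolding g_def[of p]
  proof (rule cSUP_least[OF assms(4)])
    fix x assume "x \<in> \<Omega>"
    then show "fst x - dist p (snd x) \<le> g q + dist p q"
      using g_ge[of x q] dist_triangle[of q "snd x" p] by (simp add: dist_commute)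
  qed
  have flip: "f q - dist p q \<le> f p" for p q
    unfolding f_def[of p]
  proof (rule cINF_greatest[OF assms(4)])
    fix x assume "x \<in> \<Omega>"
    then show "f q - dist p q \<le> fst x + dist p (snd x)"
      using f_le[of x q] dist_triangle[of q "snd x" p] by (simp add: dist_commute)
  qed
  have lip: "1-lipschitz_on UNIV g" "1-lipschitz_on UNIV f"
  proof (safe intro!: lipschitz_onI)
    fix p q
    show "dist (g p) (g q) \<le> 1 * dist p q"
      using glip[of p q] glip[of q p] by (simp add: dist_real_def dist_commute abs_le_iff)
    show "dist (f p) (f q) \<le> 1 * dist p q"
      using flip[of p q] flip[of q p] by (simp add: dist_real_def dist_commute abs_le_iff)
  qed auto
  have cont: "continuous_on UNIV f" "continuous_on UNIV g"
    using lip lipschitz_on_continuous_on by blast+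
  have \<Omega>: "\<Omega> = {x. f (snd x) < fst x \<and> fst x < g (snd x)}"
  proof (intro set_eqI iffI)
    fix x assume x: "x \<in> \<Omega>"
    then obtain e where e: "0 < e" "ball x e \<subseteq> \<Omega>" using assms(1) open_contains_ball by blast
    \<comment> \<open>Room above and below \<open>x\<close> makes the inequalities for the two
      envelopes strict.\<close>
    have "x + (e / 2, 0) \<in> ball x e" "x + (- e / 2, 0) \<in> ball x e"
      using e(1) by (auto simp: dist_norm norm_Pair)
    then have "x + (e / 2, 0) \<in> \<Omega>" "x + (- e / 2, 0) \<in> \<Omega>" using e(2) by auto
    then have "fst x + e / 2 \<le> g (snd x)" "f (snd x) \<le> fst x - e / 2"
      using g_ge[of "x + (e / 2, 0)" "snd x"] f_le[of "x + (- e / 2, 0)" "snd x"] by auto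
    then show "x \<in> {x. f (snd x) < fst x \<and> fst x < g (snd x)}" using e(1) by simp
  next
    fix x assume x: "x \<in> {x. f (snd x) < fst x \<and> fst x < g (snd x)}"
    \<comment> \<open>Strictness in the supremum and infimum provides points of \<Omega> in the
      future and in the past of \<open>x\<close>; causal convexity then captures
      \<open>x\<close>.\<close>
    then have "\<exists>a\<in>\<Omega>. fst x < fst a - dist (snd x) (snd a)"
      unfolding g_def using less_cSUP_iff[OF assms(4) bddg] by simp
    moreover from x have "\<exists>b\<in>\<Omega>. fst b + dist (snd x) (snd b) < fst x"
      unfolding f_def using cINF_less_iff[OF assms(4) bddf] by simp
    ultimately obtain a b where a: "a \<in> \<Omega>" "fst x < fst a - dist (snd x) (snd a)"
      and b: "b \<in> \<Omega>" "fst b + dist (snd x) (snd b) < fst x" by blast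
    have "b + (x - b) + (a - x) = a" by simp
    moreover have "norm (snd (x - b)) < fst (x - b)" "norm (snd (a - x)) < fst (a - x)"
      using a b by (auto simp: dist_norm norm_minus_commute)
    moreover from this have "0 < fst (x - b)" "0 < fst (a - x)"
      using norm_ge_zero[of "snd (x - b)"] norm_ge_zero[of "snd (a - x)"] by linarith+
    ultimately have "b + (x - b) \<in> \<Omega>"
      using a b by (intro causally_convex_between[OF assms(3) b(1), of "x - b" "a - x"]) auto
    then show "x \<in> \<Omega>" by simp
  qed
  let ?U = "{p. f p < g p}"
  have "open ?U" using cont by (intro open_Collect_less) auto
  moreover have "f p = g p" if "p \<in> frontier ?U" for p
  proof -
    have "p \<notin> ?U" using that \<open>open ?U\<close> by (simp add: frontier_def interior_open)
    moreover have "closed {p. f p \<le> g p}" using cont by (intro closed_Collect_le) auto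
    then have "closure ?U \<subseteq> {p. f p \<le> g p}" by (intro closure_minimal) auto
    then have "p \<in> {p. f p \<le> g p}" using that by (auto simp: frontier_def)
    ultimately show ?thesis by simp
  qed
  moreover have "ereal_lipschitz1 (closure ?U) (\<lambda>p. ereal (f p))" "ereal_lipschitz1 (closure ?U) (\<lambda>p. ereal (g p))"
    unfolding ereal_lipschitz1_def using lip lipschitz_on_subset[OF _ subset_UNIV] by blast+
  moreover have "\<Omega> = {(t, p). p \<in> ?U \<and> ereal (f p) < ereal t \<and> ereal t < ereal (g p)}"
    unfolding \<Omega> by auto
  ultimately have "causal_representation \<Omega> ?U (\<lambda>p. ereal (f p)) (\<lambda>p. ereal (g p))"
    unfolding causal_representation_def by simp
  then show ?thesis using that cont \<Omega> by blast
qed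

text \<open>A boundary point nearest to \<open>p\<close> lies on the upper or the lower graph, and
  this decides \<sigma>. The end of the ray has a vertical gap \<open>h\<close> to the same graph,
  so \<open>escape_time_bound\<close> compares two points of one acausal set.\<close>

lemma convex_null_escape:
  fixes \<Omega> :: "'n::finite mink set"
  assumes op: "open \<Omega>" "bounded \<Omega>" "\<Omega> \<noteq> {}" and cc: "causally_convex \<Omega>"
    and \<epsilon>: "0 < \<epsilon>" "eps_stably_acausal \<epsilon> (future_causal_boundary \<Omega>)"
    and \<eta>: "0 < \<eta>" "eps_stably_acausal \<eta> (past_causal_boundary \<Omega>)"
  shows "null_escape \<Omega> (max ((2 + \<epsilon>) / \<epsilon>) ((2 + \<eta>) / \<eta>))"
proof -
  have ne: "\<Omega> \<noteq> UNIV" using op(2) not_bounded_UNIV by metis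
  obtain f g :: "real ^ 'n \<Rightarrow> real" where cont: "continuous_on UNIV f" "continuous_on UNIV g"
    and \<Omega>: "\<Omega> = {x. f (snd x) < fst x \<and> fst x < g (snd x)}"
    and rep: "causal_representation \<Omega> {p. f p < g p} (\<lambda>p. ereal (f p)) (\<lambda>p. ereal (g p))"
    using bounded_causal_representation[OF op(1,2) cc op(3)] by blast
  let ?U = "{p. f p < g p}"
  have top: "(g p, p) \<in> future_causal_boundary \<Omega>" and bot: "(f p, p) \<in> past_causal_boundary \<Omega>"
    if "p \<in> closure ?U" for p
    using rep that unfolding future_causal_boundary_def past_causal_boundary_def by blast+
  let ?K = "max ((2 + \<epsilon>) / \<epsilon>) ((2 + \<eta>) / \<eta>)"
  show ?thesis
    unfolding null_escape_def
  proof
    fix p assume p: "p \<in> \<Omega>"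
    let ?D = "infdist p (-\<Omega>)"
    have K: "(2 + \<epsilon>) / \<epsilon> * ?D \<le> ?K * ?D" "(2 + \<eta>) / \<eta> * ?D \<le> ?K * ?D"
      by (intro mult_right_mono; simp add: infdist_nonneg)+
    obtain z where z: "z \<in> frontier \<Omega>" "dist p z \<le> ?D"
      using frontier_within_infdist[OF p op(1) ne] by blast
    \<comment> \<open>Projecting shows that \<open>z\<close> lies over the closure of U, where both
      boundary graphs are defined.\<close>
    have "snd ` closure \<Omega> \<subseteq> closure (snd ` \<Omega>)"
      by (intro image_closure_subset closed_closure closure_subset continuous_intros)
    moreover have "snd ` \<Omega> \<subseteq> ?U" unfolding \<Omega> by auto
    ultimately have zU: "snd z \<in> closure ?U"
      using z(1) closure_mono[of "snd ` \<Omega>" ?U] by (auto simp: frontier_def)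
    have "closed {x :: 'n mink. f (snd x) \<le> fst x \<and> fst x \<le> g (snd x)}"
      using cont by (intro closed_Collect_conj closed_Collect_le continuous_intros
        continuous_on_compose2[OF cont(1)] continuous_on_compose2[OF cont(2)]) auto
    then have "closure \<Omega> \<subseteq> {x. f (snd x) \<le> fst x \<and> fst x \<le> g (snd x)}"
      unfolding \<Omega> by (intro closure_minimal) auto
    then have "f (snd z) \<le> fst z" "fst z \<le> g (snd z)" using z(1) by (auto simp: frontier_def)
    moreover have "z \<notin> \<Omega>" using z(1) op(1) by (simp add: frontier_def interior_open)
    ultimately have "z = (g (snd z), snd z) \<or> z = (f (snd z), snd z)"
      unfolding \<Omega> by (auto simp: prod_eq_iff)
    then consider "z \<in> future_causal_boundary \<Omega>" | "z \<in> past_causal_boundary \<Omega>"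
      using top[OF zU] bot[OF zU] by metis
    then show "\<exists>\<sigma>\<in>{1,-1}. \<forall>w \<tau>. lightlike mink_form w \<and> fst w = 1 \<and> 0 \<le> \<tau> \<and>
        p + (\<sigma> * \<tau>) *\<^sub>R w \<in> \<Omega> \<longrightarrow> \<tau> \<le> ?K * ?D"
    proof cases
      case 1
      show ?thesis
      proof (intro bexI[of _ 1] allI impI; (elim conjE)?)
        fix w \<tau> assume w: "lightlike mink_form w" "fst w = 1" and "0 \<le> \<tau>" and q: "p + (1 * \<tau>) *\<^sub>R w \<in> \<Omega>"
        define q where "q = p + (1 * \<tau>) *\<^sub>R w"
        define h where "h = g (snd q) - fst q"
        have "q \<in> \<Omega>" using q by (simp add: q_def)
        then have h: "0 \<le> h" "snd q \<in> closure ?U" using closure_subset[of ?U] by (auto simp: h_def \<Omega>)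
        have eq: "(g (snd q), snd q) = p + (1 * \<tau>) *\<^sub>R w + (1 * h, 0)"
          unfolding q_def[symmetric] by (simp add: h_def prod_eq_iff)
        have "\<tau> \<le> (2 + \<epsilon>) / \<epsilon> * ?D"
          by (rule escape_time_bound[OF \<epsilon>(1) w _ \<open>0 \<le> \<tau>\<close> h(1) z(2) eq
              eps_stably_acausal_slope[OF \<epsilon>(2) less_imp_le[OF \<epsilon>(1)] 1 top[OF h(2)]]]) simp
        then show "\<tau> \<le> ?K * ?D" using K by linarith
      qed simp
    next
      case 2
      show ?thesis
      proof (intro bexI[of _ "-1"] allI impI; (elim conjE)?)
        fix w \<tau> assume w: "lightlike mink_form w" "fst w = 1" and "0 \<le> \<tau>" and q: "p + (-1 * \<tau>) *\<^sub>R w \<in> \<Omega>"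
        define q where "q = p + (-1 * \<tau>) *\<^sub>R w"
        define h where "h = fst q - f (snd q)"
        have "q \<in> \<Omega>" using q by (simp add: q_def)
        then have h: "0 \<le> h" "snd q \<in> closure ?U" using closure_subset[of ?U] by (auto simp: h_def \<Omega>)
        have eq: "(f (snd q), snd q) = p + (-1 * \<tau>) *\<^sub>R w + (-1 * h, 0)"
          unfolding q_def[symmetric] by (simp add: h_def prod_eq_iff)
        have "\<tau> \<le> (2 + \<eta>) / \<eta> * ?D"
          by (rule escape_time_bound[OF \<eta>(1) w _ \<open>0 \<le> \<tau>\<close> h(1) z(2) eq
              eps_stably_acausal_slope[OF \<eta>(2) less_imp_le[OF \<eta>(1)] 2 bot[OF h(2)]]]) simp
        then show "\<tau> \<le> ?K * ?D" using K by linarith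
      qed simp
    qed
  qed
qed

theorem theorem5p1:
  fixes \<Omega> :: "(real \<times> (real ^ 'n)) set"
  assumes "(mink_domain \<Omega> \<and> future_complete \<Omega> \<and> stably_acausal (frontier \<Omega>)) \<or>
           (mink_domain \<Omega> \<and> bounded \<Omega> \<and> convex \<Omega> \<and> causally_convex \<Omega> \<and>
            stably_acausal (future_causal_boundary \<Omega>) \<and>
            stably_acausal (past_causal_boundary \<Omega>))"
  shows "gromov_hyperbolic \<Omega> (markowitz_dist \<Omega>)"
  using assms
proof (elim disjE conjE)
  assume "mink_domain \<Omega>" "future_complete \<Omega>" "stably_acausal (frontier \<Omega>)"
  then obtain \<epsilon> where "open \<Omega>" "\<Omega> \<noteq> UNIV" "future_complete \<Omega>" "0 < \<epsilon>" "eps_stably_acausal \<epsilon> (frontier \<Omega>)"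
    unfolding mink_domain_def stably_acausal_def by blast
  then show ?thesis
    using markowitz_hyperbolic_criterion[OF _ _ future_complete_null_escape future_complete_cone_connected]
    by simp
next
  assume "mink_domain \<Omega>" and \<Omega>: "bounded \<Omega>" "convex \<Omega>" "causally_convex \<Omega>"
    and "stably_acausal (future_causal_boundary \<Omega>)" "stably_acausal (past_causal_boundary \<Omega>)"
  then obtain \<epsilon> \<eta> where op: "open \<Omega>" "\<Omega> \<noteq> UNIV" "\<Omega> \<noteq> {}"
    and "0 < \<epsilon>" "eps_stably_acausal \<epsilon> (future_causal_boundary \<Omega>)"
      "0 < \<eta>" "eps_stably_acausal \<eta> (past_causal_boundary \<Omega>)"
    unfolding mink_domain_def stably_acausal_def by blast
  then have "null_escape \<Omega> (max ((2 + \<epsilon>) / \<epsilon>) ((2 + \<eta>) / \<eta>))"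
    by (intro convex_null_escape \<Omega>)
  moreover obtain \<kappa> \<Lambda> where "0 < \<kappa>" "0 \<le> \<Lambda>" "cone_connected \<Omega> \<kappa> \<Lambda>"
    using convex_cone_connected[OF op(1) \<Omega>(1,2) op(3)] by blast
  ultimately show ?thesis using markowitz_hyperbolic_criterion[OF op(1,2)] by blast
qed

end
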